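(* Let $\mathcal{G}$ be a hereditary graph class. Then for every $k$ and every graph $H$ that does not contain the complete graph $K_k$ as a minor, $$\operatorname{ic}_g^{\mathcal{G}}(H)\le\frac{25(k-1)^4}{8}\cdot\operatorname{c}_g^{\mathcal{G}}(H).$$ In particular, for every graph $M$, every class $\mathcal{H}$ of $M$-minor-free graphs is $(\operatorname{ic}_g^{\mathcal{G}},\operatorname{c}_g^{\mathcal{G}})$-bounded.
   Context: Graphs are finite and simple; graph classes are closed under isomorphism. A class is hereditary if it is closed under taking induced subgraphs. A $\mathcal{G}$-cover of a graph $H$ is a graph homomorphism $\varphi\colon G_1\sqcup\dots\sqcup G_t\to H$ (disjoint union) with $G_i\in\mathcal{G}$ for all $i$, such that every edge of $H$ is the image of some edge. It is injective if each $G_i$ is isomorphic via $\varphi$ to its image $\varphi(G_i)\subseteq H$; it is induced if each image $\varphi(G_i)$ is an induced subgraph of $H$. The global covering number $\operatorname{c}_g^{\mathcal{G}}(H)$ is the smallest $t$ such that $H$ has an injective $\mathcal{G}$-cover with $t$ guests $G_1,\dots,G_t$. The global-induced covering number $\operatorname{ic}_g^{\mathcal{G}}(H)$ is the smallest $t$ such that $H$ has an injective induced $\mathcal{G}$-cover with $t$ guests. Each is $\infty$ if no such cover exists, and inequalities are asserted only when $\operatorname{c}_g^{\mathcal{G}}(H)<\infty$. A graph class $\mathcal{H}$ is $(\operatorname{ic}_g^{\mathcal{G}},\operatorname{c}_g^{\mathcal{G}})$-bounded if there is a function $f\colon\mathbb{N}\to\mathbb{N}$ with $\operatorname{ic}_g^{\mathcal{G}}(H)\le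 f(\operatorname{c}_g^{\mathcal{G}}(H))$ for every $H\in\mathcal{H}$ with $\operatorname{c}_g^{\mathcal{G}}(H)<\infty$. *)

theory Defs
  imports "Graph_Theory.Graph_Theory" "HOL-Library.Extended_Real"
begin

text \<open>A finite simple graph is a value of type \<^typ>\<open>'a pair_pre_digraph\<close> satisfying
  \<^const>\<open>pair_graph\<close>: finite, loop-free, with a symmetric arc set. The undirected edge
  \<open>uv\<close> is the pair of arcs \<open>(u, v)\<close>, \<open>(v, u)\<close>. The null graph counts as a graph.\<close>

section \<open>Graph classes\<close>

definition graph_class :: "'a pair_pre_digraph set \<Rightarrow> bool" where
  "graph_class \<G> \<longleftrightarrow> (\<forall>G\<in>\<G>. pair_graph G) \<and>
     (\<forall>G\<in>\<G>. \<forall>G'::'a pair_pre_digraph.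
        pair_graph G' \<longrightarrow> digraph_iso (with_proj G) (with_proj G') \<longrightarrow> G' \<in> \<G>)"

definition hereditary :: "'a pair_pre_digraph set \<Rightarrow> bool" where
  "hereditary \<G> \<longleftrightarrow>
     (\<forall>G\<in>\<G>. \<forall>G'. induced_subgraph (with_proj G') (with_proj G) \<longrightarrow> G' \<in> \<G>)"

section \<open>Homomorphisms and covers\<close>

definition graph_hom :: "('a \<Rightarrow> 'b) \<Rightarrow> 'a pair_pre_digraph \<Rightarrow> 'b pair_pre_digraph \<Rightarrow> bool" where
  "graph_hom f G H \<longleftrightarrow> (\<forall>v\<in>pverts G. f v \<in> pverts H) \<and>
     (\<forall>u v. (u, v) \<in> parcs G \<longrightarrow> (f u, f v) \<in> parcs H)"

definition graph_image :: "('a \<Rightarrow> 'b) \<Rightarrow> 'a pair_pre_digraph \<Rightarrow> 'b pair_pre_digraph" where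
  "graph_image f G = \<lparr> pverts = f ` pverts G, parcs = map_prod f f ` parcs G \<rparr>"

definition iso_via :: "('a \<Rightarrow> 'b) \<Rightarrow> 'a pair_pre_digraph \<Rightarrow> 'b pair_pre_digraph \<Rightarrow> bool" where
  "iso_via f G H \<longleftrightarrow> bij_betw f (pverts G) (pverts H) \<and>
     (\<forall>u\<in>pverts G. \<forall>v\<in>pverts G. (u, v) \<in> parcs G \<longleftrightarrow> (f u, f v) \<in> parcs H)"

text \<open>The copy of the \<open>i\<close>-th graph of a list \<open>Gs\<close> in the disjoint union has vertices \<open>(i, v)\<close>.\<close>

definition disj_union :: "'a pair_pre_digraph list \<Rightarrow> (nat \<times> 'a) pair_pre_digraph" where
  "disj_union Gs =
     \<lparr> pverts = {(i, v). i < length Gs \<and> v \<in> pverts (Gs ! i)},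
       parcs = {((i, u), (j, v)). i = j \<and> i < length Gs \<and> (u, v) \<in> parcs (Gs ! i)} \<rparr>"

definition is_cover ::
    "'g pair_pre_digraph set \<Rightarrow> 'h pair_pre_digraph \<Rightarrow> 'g pair_pre_digraph list
      \<Rightarrow> (nat \<times> 'g \<Rightarrow> 'h) \<Rightarrow> bool" where
  "is_cover \<G> H Gs \<phi> \<longleftrightarrow> set Gs \<subseteq> \<G> \<and> graph_hom \<phi> (disj_union Gs) H \<and>
     (\<forall>(u, v) \<in> parcs H. \<exists>(x, y) \<in> parcs (disj_union Gs). \<phi> x = u \<and> \<phi> y = v)"

definition guest_map :: "(nat \<times> 'g \<Rightarrow> 'h) \<Rightarrow> nat \<Rightarrow> 'g \<Rightarrow> 'h" where
  "guest_map \<phi> i = (\<lambda>v. \<phi> (i, v))"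

definition injective_cover ::
    "'g pair_pre_digraph list \<Rightarrow> (nat \<times> 'g \<Rightarrow> 'h) \<Rightarrow> bool" where
  "injective_cover Gs \<phi> \<longleftrightarrow>
     (\<forall>i<length Gs. iso_via (guest_map \<phi> i) (Gs ! i) (graph_image (guest_map \<phi> i) (Gs ! i)))"

definition induced_cover ::
    "'h pair_pre_digraph \<Rightarrow> 'g pair_pre_digraph list \<Rightarrow> (nat \<times> 'g \<Rightarrow> 'h) \<Rightarrow> bool" where
  "induced_cover H Gs \<phi> \<longleftrightarrow>
     (\<forall>i<length Gs.
        induced_subgraph (with_proj (graph_image (guest_map \<phi> i) (Gs ! i))) (with_proj H))"

text \<open>In \<^typ>\<open>enat\<close> the infimum of a nonempty set is attained, and the infimum of the empty set
  is \<open>\<infinity>\<close>.\<close>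

definition c_g :: "'g pair_pre_digraph set \<Rightarrow> 'h pair_pre_digraph \<Rightarrow> enat" where
  "c_g \<G> H = Inf {enat (length Gs) | Gs. \<exists>\<phi>. is_cover \<G> H Gs \<phi> \<and> injective_cover Gs \<phi>}"

definition ic_g :: "'g pair_pre_digraph set \<Rightarrow> 'h pair_pre_digraph \<Rightarrow> enat" where
  "ic_g \<G> H = Inf {enat (length Gs) | Gs.
     \<exists>\<phi>. is_cover \<G> H Gs \<phi> \<and> injective_cover Gs \<phi> \<and> induced_cover H Gs \<phi>}"

definition param_bounded ::
    "('h pair_pre_digraph \<Rightarrow> enat) \<Rightarrow> ('h pair_pre_digraph \<Rightarrow> enat)
      \<Rightarrow> 'h pair_pre_digraph set \<Rightarrow> bool" where
  "param_bounded p q \<H> \<longleftrightarrow>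
     (\<exists>f::nat \<Rightarrow> nat. \<forall>H\<in>\<H>. \<forall>n. q H = enat n \<longrightarrow> p H \<le> enat (f n))"

section \<open>Minors\<close>

definition complete_pgraph :: "nat \<Rightarrow> nat pair_pre_digraph" where
  "complete_pgraph k = \<lparr> pverts = {..<k}, parcs = {(i, j). i < k \<and> j < k \<and> i \<noteq> j} \<rparr>"

text \<open>\<open>B\<close> assigns to the vertices of \<open>M\<close> their branch sets: contracting them in a suitable subgraph
  of \<open>H\<close> yields \<open>M\<close>. \<^const>\<open>Digraph_Component.connected\<close> implies that a branch set is nonempty.\<close>

definition is_minor :: "'m pair_pre_digraph \<Rightarrow> 'h pair_pre_digraph \<Rightarrow> bool" where
  "is_minor M H \<longleftrightarrow> (\<exists>B :: 'm \<Rightarrow> 'h set.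
     (\<forall>x\<in>pverts M. B x \<subseteq> pverts H \<and> Digraph_Component.connected (with_proj H \<restriction> B x)) \<and>
     (\<forall>x\<in>pverts M. \<forall>y\<in>pverts M. x \<noteq> y \<longrightarrow> B x \<inter> B y = {}) \<and>
     (\<forall>(x, y)\<in>parcs M. \<exists>u\<in>B x. \<exists>v\<in>B y. (u, v) \<in> parcs H))"

section \<open>Basic facts\<close>

lemma pair_graph_complete: "pair_graph (complete_pgraph k)"
proof
  show "finite (parcs (complete_pgraph k))"
    by (rule finite_subset[of _ "{..<k} \<times> {..<k}"]) (auto simp: complete_pgraph_def)
qed (auto simp: complete_pgraph_def symmetric_def sym_def)

lemma complete_digraph_complete_pgraph: "complete_digraph k (with_proj (complete_pgraph k))"
proof -
  interpret pair_graph "complete_pgraph k" by (rule pair_graph_complete)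
  have "graph (with_proj (complete_pgraph k))" by unfold_locales
  then show ?thesis
    unfolding complete_digraph_def by (auto simp: complete_pgraph_def)
qed

lemma digraph_iso_iff_iso_via:
  assumes "pair_graph G" "pair_graph H"
  shows "digraph_iso (with_proj G) (with_proj H) \<longleftrightarrow> (\<exists>f. iso_via f G H)"
proof -
  interpret G: pair_graph G by fact
  interpret H: pair_graph H by fact
  show ?thesis
  proof
    assume "digraph_iso (with_proj G) (with_proj H)"
    then obtain h where h: "pre_digraph.digraph_isomorphism (with_proj G) h"
      and eq: "with_proj H = app_iso h (with_proj G)"
      unfolding digraph_iso_def by blast
    let ?f = "iso_verts h"
    from eq have v: "pverts H = ?f ` pverts G" and a: "parcs H = iso_arcs h ` parcs G"
      and t: "iso_tail h = fst" and d: "iso_head h = snd"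
      by (auto simp: with_proj_def app_iso_def)
    from h have inj: "inj_on ?f (pverts G)"
      and arc: "\<And>e. e \<in> parcs G \<Longrightarrow> iso_arcs h e = (?f (fst e), ?f (snd e))"
      unfolding pre_digraph.digraph_isomorphism_def by (auto simp: t d prod_eq_iff)
    from a arc have a': "parcs H = (\<lambda>e. (?f (fst e), ?f (snd e))) ` parcs G" by simp
    have "iso_via ?f G H"
      unfolding iso_via_def
    proof (intro conjI ballI)
      show "bij_betw ?f (pverts G) (pverts H)" using inj v by (simp add: bij_betw_def)
      fix x y assume xy: "x \<in> pverts G" "y \<in> pverts G"
      show "(x, y) \<in> parcs G \<longleftrightarrow> (?f x, ?f y) \<in> parcs H"
      proof
        assume "(?f x, ?f y) \<in> parcs H"
        then obtain e where e: "e \<in> parcs G" "?f x = ?f (fst e)" "?f y = ?f (snd e)"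
          unfolding a' by auto
        with xy have "x = fst e" "y = snd e"
          using inj by (auto dest: inj_onD G.arc_fst_in_verts G.arc_snd_in_verts)
        with e show "(x, y) \<in> parcs G" by simp
      qed (force simp: a')
    qed
    then show "\<exists>f. iso_via f G H" by blast
  next
    assume "\<exists>f. iso_via f G H"
    then obtain f where f: "iso_via f G H" by blast
    then have inj: "inj_on f (pverts G)" and im: "f ` pverts G = pverts H"
      by (auto simp: iso_via_def bij_betw_def)
    let ?h = "\<lparr> iso_verts = f, iso_arcs = map_prod f f, iso_head = snd, iso_tail = fst \<rparr>"
    have arcs: "parcs H = map_prod f f ` parcs G"
    proof (intro equalityI subrelI)
      fix u v assume uv: "(u, v) \<in> parcs H"
      then obtain x y where "x \<in> pverts G" "y \<in> pverts G" "u = f x" "v = f y"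
        using H.in_arcsD1 H.in_arcsD2 im by (metis imageE)
      with uv f show "(u, v) \<in> map_prod f f ` parcs G" by (force simp: iso_via_def)
    next
      fix u v assume "(u, v) \<in> map_prod f f ` parcs G"
      with f show "(u, v) \<in> parcs H"
        by (auto simp: iso_via_def dest: G.in_arcsD1 G.in_arcsD2)
    qed
    have "inj_on (map_prod f f) (parcs G)"
      by (rule inj_on_subset[OF map_prod_inj_on[OF inj inj]])
        (auto dest: G.in_arcsD1 G.in_arcsD2)
    moreover have "wf_digraph (with_proj G)" by unfold_locales
    ultimately have "pre_digraph.digraph_isomorphism (with_proj G) ?h"
      using inj by (simp add: pre_digraph.digraph_isomorphism_def)
    moreover have "with_proj H = app_iso ?h (with_proj G)"
      by (simp add: with_proj_def app_iso_def arcs im)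
    ultimately show "digraph_iso (with_proj G) (with_proj H)"
      unfolding digraph_iso_def by blast
  qed
qed

lemma c_g_le_ic_g: "c_g \<G> H \<le> ic_g \<G> H"
  unfolding c_g_def ic_g_def by (rule Inf_superset_mono) blast

lemma c_g_eq_enat_iff:
  "c_g \<G> H = enat t \<longleftrightarrow>
     (\<exists>Gs \<phi>. length Gs = t \<and> is_cover \<G> H Gs \<phi> \<and> injective_cover Gs \<phi>) \<and>
     (\<forall>Gs \<phi>. is_cover \<G> H Gs \<phi> \<and> injective_cover Gs \<phi> \<longrightarrow> t \<le> length Gs)"
  (is "_ \<longleftrightarrow> ?E \<and> ?L")
proof -
  let ?S = "{enat (length Gs) | Gs. \<exists>\<phi>. is_cover \<G> H Gs \<phi> \<and> injective_cover Gs \<phi>}"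
  show ?thesis
  proof
    assume eq: "c_g \<G> H = enat t"
    have "Inf A \<in> A" if "Inf A = enat t" for A :: "enat set"
      using that unfolding Inf_enat_def
      by (metis LeastI all_not_in_conv enat.distinct(1))
    from this[of ?S] have "Inf ?S \<in> ?S" using eq by (simp only: c_g_def)
    then have ?E using eq by (auto simp: c_g_def)
    moreover have ?L
    proof (intro allI impI)
      fix Gs and \<phi> :: "nat \<times> 'a \<Rightarrow> 'b"
      assume "is_cover \<G> H Gs \<phi> \<and> injective_cover Gs \<phi>"
      then have "Inf ?S \<le> enat (length Gs)" by (intro Inf_lower) blast
      then show "t \<le> length Gs" using eq by (simp add: c_g_def)
    qed
    ultimately show "?E \<and> ?L" ..
  next
    assume *: "?E \<and> ?L"
    then have "enat t \<in> ?S" by blast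
    then have "Inf ?S \<le> enat t" by (rule Inf_lower)
    moreover have "enat t \<le> Inf ?S" using * by (intro Inf_greatest) auto
    ultimately show "c_g \<G> H = enat t" by (simp add: c_g_def)
  qed
qed

end

theory Submission
  imports Defs
begin

text \<open>
  Let \<open>H\<close> be a graph without \<open>K\<^sub>k\<close> minor, \<open>k \<ge> 3\<close>. One guest of an injective cover is a subgraph of
  \<open>H\<close>; write \<open>F\<close> for its edges. Since the class is hereditary, it suffices to find
  \<open>O(k\<^sup>4)\<close> vertex sets which together contain both ends of every edge in \<open>F\<close> and in which every edge
  of \<open>H\<close> belongs to \<open>F\<close>: restricting the guest to these sets makes it induced.

  \<^bold>\<open>From a colouring to vertex sets.\<close> Suppose that \<open>H\<close> has a proper colouring with \<open>c\<close> colours and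
  a ranking of its vertices such that the lower ranked neighbours of each vertex have distinct
  colours. Then any two colours \<open>a\<close>, \<open>b\<close> span a forest in which every vertex has at most one lower
  neighbour, its parent. Walking up in rank, label each vertex with a bit that agrees with the bit
  of the parent exactly if the edge to the parent is in \<open>F\<close>. Then an edge of the forest is in \<open>F\<close> if
  and only if its ends have the same bit, so the two bit classes are as required, and all ordered
  pairs of colours give \<open>c\<^sup>2\<close> sets (\<open>induced_decomposition\<close>).

  \<^bold>\<open>The colouring.\<close> The graph is swept by geodesics. At any time, a connected set \<open>C\<close> of vertices is
  still uncoloured, and the next piece is a path in \<open>C\<close> that is shortest in \<open>C\<close>. All its vertices
  get the same new path colour, refined by the position modulo 3; the final colour encodes both.
  A vertex of \<open>C\<close> sees positions on the path that differ by at most 2, so it sees each refined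
  colour at most once, and the path colour only has to avoid those which \<open>C\<close> still sees. The
  procedure continues in each component of the rest. It remains to choose the pieces such that \<open>C\<close>
  always sees few path colours.

  \<^bold>\<open>Few path colours.\<close> The coloured part carries a partial model of a complete graph
  (\<open>partial_model\<close>): disjoint connected kernels, and disjoint connected links each joining two
  kernels, such that \<open>C\<close> sees at most one path colour in each kernel and in each link. If all
  kernels are adjacent to \<open>C\<close> and any two are linked or adjacent, then they form together with \<open>C\<close> a
  complete minor; hence there are at most \<open>k - 2\<close> kernels, and a new vertex of \<open>C\<close> can be made a
  kernel. Otherwise a missing link is added, as a geodesic in \<open>C\<close> between the two kernels.
  When \<open>C\<close> shrinks, a kernel may lose its contact to \<open>C\<close>. If one of its links is still adjacent to
  \<open>C\<close>, then the kernel absorbs this link; the link vanishes, but its two kernels are adjacent now,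
  and the colour of the link becomes the only visible colour of the kernel. If none of its links is
  adjacent to \<open>C\<close>, then the kernel is dropped, which leaves no visible vertex uncovered
  (\<open>anchored_model_exists\<close>). So \<open>n\<close> kernels account for at most \<open>n + (n choose 2)\<close> visible path
  colours. For \<open>n = k - 1\<close> at least two pairs have no link, so at most \<open>(k choose 2) - 2\<close> path colours
  are visible when a new one is chosen (\<open>card_touched_colours\<close>). Hence \<open>(k choose 2) - 1\<close> path colours
  suffice, that is \<open>c = 3 ((k choose 2) - 1)\<close>, and \<open>c\<^sup>2 \<le> 25 (k - 1)\<^sup>4 / 8\<close>.

  For \<open>k \<le> 2\<close> the graph has no edges. A graph without \<open>M\<close> minor has no complete minor on as many
  vertices as \<open>M\<close>, so the bound for complete minors gives the second part.
\<close>

section \<open>Connected vertex sets\<close>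

locale finite_simple_graph =
  fixes V :: "'a set" and E :: "'a \<Rightarrow> 'a \<Rightarrow> bool"
  assumes finite_V: "finite V"
    and E_sym: "E u v \<Longrightarrow> E v u"
    and E_irrefl: "\<not> E v v"
    and E_in_V: "E u v \<Longrightarrow> u \<in> V"
begin

definition touches :: "'a set \<Rightarrow> 'a set \<Rightarrow> bool" where
  "touches A B \<longleftrightarrow> (\<exists>a\<in>A. \<exists>b\<in>B. E a b)"

text \<open>Connectivity as absence of a nontrivial closed subset. In this form, unions of touching connected
  sets are handled without any paths.\<close>

definition conn :: "'a set \<Rightarrow> bool" where
  "conn S \<longleftrightarrow> S \<noteq> {} \<and>
     (\<forall>A. A \<subseteq> S \<longrightarrow> A \<noteq> {} \<longrightarrow> (\<forall>a\<in>A. \<forall>b\<in>S. E a b \<longrightarrow> b \<in> A) \<longrightarrow> A = S)"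

definition outer_nbrs :: "'a set \<Rightarrow> 'a set" where
  "outer_nbrs C = {v. v \<notin> C \<and> (\<exists>u\<in>C. E u v)}"

definition component :: "'a set \<Rightarrow> 'a \<Rightarrow> 'a set" where
  "component D x = {y. (\<lambda>a b. E a b \<and> b \<in> D)\<^sup>*\<^sup>* x y}"

lemma touches_sym: "touches A B \<longleftrightarrow> touches B A"
  unfolding touches_def using E_sym by blast

lemma touches_mono: "touches A B \<Longrightarrow> A \<subseteq> A' \<Longrightarrow> B \<subseteq> B' \<Longrightarrow> touches A' B'"
  unfolding touches_def by blast

lemma conn_nonempty: "conn S \<Longrightarrow> S \<noteq> {}"
  by (simp add: conn_def)

lemma conn_closed:
  assumes "conn S" "A \<subseteq> S" "A \<noteq> {}" "\<And>a b. a \<in> A \<Longrightarrow> b \<in> S \<Longrightarrow> E a b \<Longrightarrow> b \<in> A"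
  shows "A = S"
  using assms unfolding conn_def by blast

lemma conn_singleton: "conn {x}"
  unfolding conn_def by auto

lemma conn_Un:
  assumes "conn S" "conn T" "touches S T"
  shows "conn (S \<union> T)"
  unfolding conn_def
proof (intro conjI allI impI)
  show "S \<union> T \<noteq> {}" using conn_nonempty[OF assms(1)] by simp
  fix A assume A: "A \<subseteq> S \<union> T" "A \<noteq> {}" and cl: "\<forall>a\<in>A. \<forall>b\<in>S \<union> T. E a b \<longrightarrow> b \<in> A"
  obtain s t where st: "s \<in> S" "t \<in> T" "E s t" using assms(3) unfolding touches_def by blast
  have S: "A \<inter> S = S" if "A \<inter> S \<noteq> {}"
    using conn_closed[OF assms(1) _ that] cl by blast
  have T: "A \<inter> T = T" if "A \<inter> T \<noteq> {}"
    using conn_closed[OF assms(2) _ that] cl by blast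
  have "A \<inter> S \<noteq> {} \<or> A \<inter> T \<noteq> {}" using A by blast
  then have "s \<in> A \<or> t \<in> A" using S T st by blast
  then have "s \<in> A" "t \<in> A" using cl st E_sym by blast+
  then show "A = S \<union> T" using S T st A by blast
qed

lemma conn_Un_Union:
  assumes "conn K" "finite F" "\<And>P. P \<in> F \<Longrightarrow> P = {} \<or> conn P \<and> touches P K"
  shows "conn (K \<union> \<Union>F)"
  using assms(2,3)
proof (induction F)
  case empty
  then show ?case using assms(1) by simp
next
  case (insert P F)
  then have IH: "conn (K \<union> \<Union>F)" by blast
  show ?case
  proof (cases "P = {}")
    case False
    then have "conn P" "touches P K" using insert.prems by blast+
    then have "conn ((K \<union> \<Union>F) \<union> P)"
      using conn_Un[OF IH \<open>conn P\<close>] touches_mono[of P K P "K \<union> \<Union>F"] touches_sym by blast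
    then show ?thesis by (simp add: Un_ac)
  qed (use IH in simp)
qed

lemma component_self: "x \<in> component D x"
  by (simp add: component_def)

lemma component_subset: "x \<in> D \<Longrightarrow> component D x \<subseteq> D"
  unfolding component_def by (auto elim: rtranclp.cases)

lemma component_step: "y \<in> component D x \<Longrightarrow> E y z \<Longrightarrow> z \<in> D \<Longrightarrow> z \<in> component D x"
  unfolding component_def by (auto intro: rtranclp.rtrancl_into_rtrancl)

lemma component_sym:
  assumes "x \<in> D" "y \<in> component D x"
  shows "x \<in> component D y"
proof -
  have "(\<lambda>a b. E a b \<and> b \<in> D)\<^sup>*\<^sup>* x y" using assms(2) by (simp add: component_def)
  then have "y \<in> D \<and> (\<lambda>a b. E a b \<and> b \<in> D)\<^sup>*\<^sup>* y x"
  proof (induction rule: rtranclp_induct)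
    case base
    then show ?case using assms(1) by simp
  next
    case (step y z)
    then show ?case using E_sym by (auto intro: converse_rtranclp_into_rtranclp)
  qed
  then show ?thesis by (simp add: component_def)
qed

lemma component_eq:
  assumes "x \<in> D" "y \<in> component D x"
  shows "component D y = component D x"
  using assms(2) component_sym[OF assms] unfolding component_def
  by (auto intro: rtranclp_trans)

lemma conn_component:
  assumes "x \<in> D"
  shows "conn (component D x)"
  unfolding conn_def
proof (intro conjI allI impI)
  show "component D x \<noteq> {}" using component_self by blast
  fix A assume A: "A \<subseteq> component D x" "A \<noteq> {}"
    and cl: "\<forall>a\<in>A. \<forall>b\<in>component D x. E a b \<longrightarrow> b \<in> A"
  obtain a where a: "a \<in> A" using A by blast
  then have eq: "component D a = component D x" using A component_eq[OF assms] by blast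
  have "y \<in> A" if "y \<in> component D a" for y
  proof -
    have "(\<lambda>a b. E a b \<and> b \<in> D)\<^sup>*\<^sup>* a y" using that by (simp add: component_def)
    then show ?thesis
    proof (induction rule: rtranclp_induct)
      case base
      show ?case by (rule a)
    next
      case (step y z)
      then show ?case using A cl component_step[of y D x z] by blast
    qed
  qed
  then show "A = component D x" using A eq by blast
qed

lemma outer_nbrs_component:
  assumes "x \<in> D"
  shows "outer_nbrs (component D x) \<inter> D = {}"
  unfolding outer_nbrs_def using component_step by blast

lemma touches_iff_outer_nbrs: "A \<inter> C = {} \<Longrightarrow> touches A C \<longleftrightarrow> A \<inter> outer_nbrs C \<noteq> {}"
  unfolding touches_def outer_nbrs_def using E_sym by blast

section \<open>Geodesics\<close>

text \<open>The function \<open>d\<close> is the distance from \<open>A\<close> inside \<open>C\<close>; only its local properties matter later.\<close>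

lemma distance_levels:
  assumes C: "conn C" and A: "A \<subseteq> C" "A \<noteq> {}"
  obtains d :: "'a \<Rightarrow> nat" where
    "\<And>x. x \<in> C \<Longrightarrow> d x = 0 \<Longrightarrow> x \<in> A"
    "\<And>x y. x \<in> C \<Longrightarrow> y \<in> C \<Longrightarrow> E x y \<Longrightarrow> d y \<le> Suc (d x)"
    "\<And>x n. x \<in> C \<Longrightarrow> d x = Suc n \<Longrightarrow> \<exists>y\<in>C. E y x \<and> d y = n"
proof -
  let ?R = "\<lambda>x y. E x y \<and> x \<in> C \<and> y \<in> C"
  define reach where "reach n x \<longleftrightarrow> (\<exists>a\<in>A. (?R ^^ n) a x)" for n x
  define d where "d x = (LEAST n. reach n x)" for x
  have reach_0: "reach 0 x \<longleftrightarrow> x \<in> A" for x by (auto simp: reach_def)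
  have reach_Suc: "reach (Suc n) x \<longleftrightarrow> (\<exists>y. reach n y \<and> ?R y x)" for n x
    by (auto simp: reach_def relcompp_apply)
  have "{x\<in>C. \<exists>n. reach n x} = C"
  proof (rule conn_closed[OF C])
    show "{x\<in>C. \<exists>n. reach n x} \<noteq> {}" using A reach_0 by blast
    fix a b assume "a \<in> {x\<in>C. \<exists>n. reach n x}" "b \<in> C" "E a b"
    then obtain n where "reach (Suc n) b" unfolding reach_Suc by blast
    then show "b \<in> {x\<in>C. \<exists>n. reach n x}" using \<open>b \<in> C\<close> by blast
  qed blast
  then have d: "reach (d x) x" if "x \<in> C" for x
  proof -
    have "\<exists>n. reach n x" using that \<open>_ = C\<close> by blast
    then show ?thesis unfolding d_def by (rule LeastI_ex)
  qed
  have d_le: "d x \<le> n" if "reach n x" for x n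
    unfolding d_def using that by (rule Least_le)
  have lip: "d y \<le> Suc (d x)" if "x \<in> C" "y \<in> C" "E x y" for x y
    using d[OF that(1)] that by (intro d_le) (auto simp: reach_Suc)
  show thesis
  proof
    show "x \<in> A" if "x \<in> C" "d x = 0" for x using d[OF that(1)] that(2) by (simp add: reach_0)
    show "d y \<le> Suc (d x)" if "x \<in> C" "y \<in> C" "E x y" for x y by (rule lip[OF that])
    show "\<exists>y\<in>C. E y x \<and> d y = n" if x: "x \<in> C" "d x = Suc n" for x n
    proof -
      have "reach (Suc n) x" using d[OF x(1)] x(2) by simp
      then obtain y where y: "reach n y" "E y x" "y \<in> C" unfolding reach_Suc by blast
      have "d y \<le> n" using d_le[OF y(1)] .
      moreover have "Suc n \<le> Suc (d y)" using lip[OF y(3) x(1) y(2)] x(2) by simp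
      ultimately show ?thesis using y by auto
    qed
  qed
qed

text \<open>A shortest path \<open>Q\<close> from \<open>A\<close> to \<open>b\<close>, stripped to what the colouring uses: a level function that
  is injective on \<open>Q\<close> and changes by at most 1 along edges of \<open>C\<close>. Two vertices of \<open>Q\<close> with a common
  neighbour in \<open>C\<close> therefore have levels that differ by 1 or 2, and each vertex of \<open>Q\<close> has at most
  one neighbour in \<open>Q\<close> of lower level. The path is traced back from \<open>b\<close>, one vertex per level.\<close>

lemma geodesic_exists:
  assumes C: "conn C" and A: "A \<subseteq> C" "A \<noteq> {}" and b: "b \<in> C"
  obtains Q and d :: "'a \<Rightarrow> nat" where
    "Q \<subseteq> C" "conn Q" "b \<in> Q" "Q \<inter> A \<noteq> {}" "inj_on d Q"
    "\<And>x y. x \<in> C \<Longrightarrow> y \<in> C \<Longrightarrow> E x y \<Longrightarrow> d y \<le> Suc (d x)"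
proof -
  obtain d :: "'a \<Rightarrow> nat" where d0: "\<And>x. x \<in> C \<Longrightarrow> d x = 0 \<Longrightarrow> x \<in> A"
    and lip: "\<And>x y. x \<in> C \<Longrightarrow> y \<in> C \<Longrightarrow> E x y \<Longrightarrow> d y \<le> Suc (d x)"
    and pred: "\<And>x n. x \<in> C \<Longrightarrow> d x = Suc n \<Longrightarrow> \<exists>y\<in>C. E y x \<and> d y = n"
    by (rule distance_levels[OF C A]) (rule that; assumption)
  have "\<exists>Q\<subseteq>C. conn Q \<and> b \<in> Q \<and> Q \<inter> A \<noteq> {} \<and> inj_on d Q \<and> (\<forall>x\<in>Q. d x \<le> d b)" if "b \<in> C" for b
    using that
  proof (induction "d b" arbitrary: b)
    case 0
    then show ?case using d0[of b] conn_singleton[of b] by (intro exI[of _ "{b}"]) auto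
  next
    case (Suc n)
    then obtain y where y: "y \<in> C" "E y b" "d y = n" using pred by metis
    with Suc.hyps(1) obtain Q where Q: "Q \<subseteq> C" "conn Q" "y \<in> Q" "Q \<inter> A \<noteq> {}" "inj_on d Q"
      "\<forall>x\<in>Q. d x \<le> n" by metis
    have "touches Q {b}" using y Q(3) by (auto simp: touches_def)
    then have "conn (insert b Q)" using conn_Un[OF Q(2) conn_singleton[of b]] by simp
    moreover have "inj_on d (insert b Q)" using Q(5,6) Suc.hyps(2) by (auto simp: inj_on_insert)
    ultimately show ?case
      using Q Suc.prems Suc.hyps(2) by (intro exI[of _ "insert b Q"]) auto
  qed
  from this[OF b] obtain Q where "Q \<subseteq> C" "conn Q" "b \<in> Q" "Q \<inter> A \<noteq> {}" "inj_on d Q" by blast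
  then show thesis by (rule that[OF _ _ _ _ _ lip])
qed

section \<open>Partial models of complete graphs\<close>

definition clique_minor :: "nat \<Rightarrow> bool" where
  "clique_minor n \<longleftrightarrow> (\<exists>(I :: nat set) B. finite I \<and> card I = n \<and>
     (\<forall>i\<in>I. B i \<subseteq> V \<and> conn (B i)) \<and>
     (\<forall>i\<in>I. \<forall>j\<in>I. i \<noteq> j \<longrightarrow> B i \<inter> B j = {} \<and> touches (B i) (B j)))"

text \<open>A cell \<open>{u}\<close> stands for the kernel of \<open>u\<close>, a cell \<open>{u, w}\<close> for the link between \<open>u\<close> and \<open>w\<close>.
  Indexing both by sets makes links symmetric and gives one disjointness condition for all.\<close>

definition cells :: "nat set \<Rightarrow> nat set set" where
  "cells U = {s. s \<subseteq> U \<and> card s = 1} \<union> {s. s \<subseteq> U \<and> card s = 2}"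

text \<open>The coloured part as seen from the uncoloured set \<open>C\<close>: \<open>U\<close> indexes the kernels, and an empty link
  \<open>X {u, w} = {}\<close> means that \<open>u\<close> and \<open>w\<close> either have adjacent kernels or are not linked yet.
  The sixth conjunct is the reason for the whole structure: a cell shows at most one path colour
  to \<open>C\<close>. The last conjunct bounds the number of cells. With \<open>k - 1\<close> kernels the model cannot be
  complete, so one pair has no link; the conjunct supplies another empty cell, which saves the one
  colour that decides about the final constant.\<close>

definition partial_model ::
    "nat \<Rightarrow> 'a set \<Rightarrow> nat set \<Rightarrow> (nat set \<Rightarrow> 'a set) \<Rightarrow> ('a \<Rightarrow> nat) \<Rightarrow> bool" where
  "partial_model k C U X col \<longleftrightarrow>
     finite U \<and>
     (\<forall>s\<in>cells U. X s \<subseteq> V - C \<and> (X s = {} \<or> conn (X s))) \<and>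
     (\<forall>s\<in>cells U. \<forall>s'\<in>cells U. s \<noteq> s' \<longrightarrow> X s \<inter> X s' = {}) \<and>
     (\<forall>u\<in>U. \<forall>w\<in>U. u \<noteq> w \<longrightarrow> X {u, w} \<noteq> {} \<longrightarrow> touches (X {u, w}) (X {u})) \<and>
     outer_nbrs C \<subseteq> \<Union>(X ` cells U) \<and>
     (\<forall>s\<in>cells U. \<exists>c. \<forall>v\<in>X s \<inter> outer_nbrs C. col v = c) \<and>
     (card U + 2 \<le> k \<or>
      card U + 1 = k \<and> (\<exists>u\<in>U. \<exists>w\<in>U. u \<noteq> w \<and> X {u, w} = {} \<and> touches (X {u}) (X {w})))"

text \<open>Every kernel is adjacent to \<open>C\<close>. This is lost when \<open>C\<close> shrinks and has to be restored each time.\<close>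

definition anchored :: "'a set \<Rightarrow> nat set \<Rightarrow> (nat set \<Rightarrow> 'a set) \<Rightarrow> bool" where
  "anchored C U X \<longleftrightarrow> (\<forall>u\<in>U. touches (X {u}) C)"

definition missing_link :: "nat set \<Rightarrow> (nat set \<Rightarrow> 'a set) \<Rightarrow> nat \<Rightarrow> nat \<Rightarrow> bool" where
  "missing_link U X u w \<longleftrightarrow>
     u \<in> U \<and> w \<in> U \<and> u \<noteq> w \<and> X {u, w} = {} \<and> \<not> touches (X {u}) (X {w})"

lemma singleton_in_cells: "{u} \<in> cells U \<longleftrightarrow> u \<in> U"
  by (auto simp: cells_def)

lemma pair_in_cells: "u \<noteq> w \<Longrightarrow> {u, w} \<in> cells U \<longleftrightarrow> u \<in> U \<and> w \<in> U"
  by (auto simp: cells_def card_2_iff)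

lemma cells_mono: "U \<subseteq> U' \<Longrightarrow> cells U \<subseteq> cells U'"
  by (auto simp: cells_def)

lemma cells_cases:
  assumes "s \<in> cells U"
  obtains u where "s = {u}" "u \<in> U" | u w where "s = {u, w}" "u \<in> U" "w \<in> U" "u \<noteq> w"
  using assms unfolding cells_def by (auto simp: card_1_singleton_iff card_2_iff)

lemma finite_cells: "finite U \<Longrightarrow> finite (cells U)"
  by (rule finite_subset[of _ "Pow U"]) (auto simp: cells_def)

lemma card_cells:
  assumes "finite U"
  shows "card (cells U) = card U + (card U choose 2)"
proof -
  have "card (cells U) = card {s. s \<subseteq> U \<and> card s = 1} + card {s. s \<subseteq> U \<and> card s = 2}"
    unfolding cells_def using assms
    by (intro card_Un_disjoint) (auto intro: finite_subset[of _ "Pow U"])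
  then show ?thesis using n_subsets[OF assms, of 1] n_subsets[OF assms, of 2] by simp
qed

lemma partial_modelD:
  assumes "partial_model k C U X col"
  shows "finite U"
    and "\<And>s. s \<in> cells U \<Longrightarrow> X s \<subseteq> V - C"
    and "\<And>s. s \<in> cells U \<Longrightarrow> X s = {} \<or> conn (X s)"
    and "\<And>s s'. s \<in> cells U \<Longrightarrow> s' \<in> cells U \<Longrightarrow> s \<noteq> s' \<Longrightarrow> X s \<inter> X s' = {}"
    and "\<And>u w. u \<in> U \<Longrightarrow> w \<in> U \<Longrightarrow> u \<noteq> w \<Longrightarrow> X {u, w} \<noteq> {} \<Longrightarrow> touches (X {u, w}) (X {u})"
    and "outer_nbrs C \<subseteq> \<Union>(X ` cells U)"
    and "\<And>s. s \<in> cells U \<Longrightarrow> \<exists>c. \<forall>v\<in>X s \<inter> outer_nbrs C. col v = c"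
    and "card U + 2 \<le> k \<or>
      card U + 1 = k \<and> (\<exists>u\<in>U. \<exists>w\<in>U. u \<noteq> w \<and> X {u, w} = {} \<and> touches (X {u}) (X {w}))"
  using assms unfolding partial_model_def by blast+

text \<open>The kernel of \<open>u\<close> is invisible from \<open>C\<close>, so after the union it still shows a single colour, that
  of the link. The link to \<open>w\<close> is replaced by adjacency of the two kernels. Since kernels only grow,
  all other links and adjacencies persist.\<close>

lemma absorb_link:
  assumes m: "partial_model k C U X col"
    and uw: "u \<in> U" "w \<in> U" "u \<noteq> w"
    and nu: "\<not> touches (X {u}) C" and t: "touches (X {u, w}) C"
  shows "partial_model k C U (X({u} := X {u} \<union> X {u, w}, {u, w} := {})) col"
    (is "partial_model k C U ?Y col")
proof -
  note D = partial_modelD[OF m]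
  have cu: "{u} \<in> cells U" and cuw: "{u, w} \<in> cells U"
    using uw by (auto simp: singleton_in_cells pair_in_cells)
  have ne: "{u, w} \<noteq> {v}" for v using uw(3) by auto
  have ne': "{v, v'} \<noteq> {u}" if "v \<noteq> v'" for v v' using that by auto
  have Pne: "X {u, w} \<noteq> {}" using t by (auto simp: touches_def)
  have tu: "touches (X {u, w}) (X {u})" using D(5)[OF uw Pne] .
  have free: "X {u} \<inter> outer_nbrs C = {}"
    using nu D(2)[OF cu] touches_iff_outer_nbrs[of "X {u}" C] by blast
  have Yother: "?Y s = X s" if "s \<noteq> {u}" "s \<noteq> {u, w}" for s using that by simp
  have Yu: "?Y {u} = X {u} \<union> X {u, w}" using ne by simp
  have Ysub: "X {v} \<subseteq> ?Y {v}" for v using ne by auto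
  show ?thesis
    unfolding partial_model_def
  proof (intro conjI)
    show "finite U" by (rule D(1))
    show "\<forall>s\<in>cells U. ?Y s \<subseteq> V - C \<and> (?Y s = {} \<or> conn (?Y s))"
    proof
      fix s assume s: "s \<in> cells U"
      have "conn (X {u} \<union> X {u, w})"
        using conn_Un[of "X {u}" "X {u, w}"] tu touches_sym D(3)[OF cu] D(3)[OF cuw] Pne
        by (auto simp: touches_def)
      then show "?Y s \<subseteq> V - C \<and> (?Y s = {} \<or> conn (?Y s))"
        using D(2)[OF s] D(2)[OF cu] D(2)[OF cuw] D(3)[OF s] Yu Yother[of s]
        by (cases "s = {u}"; cases "s = {u, w}") auto
    qed
    show "\<forall>s\<in>cells U. \<forall>s'\<in>cells U. s \<noteq> s' \<longrightarrow> ?Y s \<inter> ?Y s' = {}"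
    proof (intro ballI impI)
      fix s s' assume s: "s \<in> cells U" "s' \<in> cells U" "s \<noteq> s'"
      have u: "?Y {u} \<inter> ?Y r = {}" if r: "r \<in> cells U" "r \<noteq> {u}" for r
        using D(4)[OF cu r(1)] D(4)[OF cuw r(1)] r(2) unfolding Yu by auto
      show "?Y s \<inter> ?Y s' = {}"
      proof (cases "s = {u} \<or> s' = {u}")
        case True
        then show ?thesis using u[of s] u[of s'] s by blast
      next
        case False
        then show ?thesis using D(4)[OF s] by auto
      qed
    qed
    show "\<forall>v\<in>U. \<forall>v'\<in>U. v \<noteq> v' \<longrightarrow> ?Y {v, v'} \<noteq> {} \<longrightarrow> touches (?Y {v, v'}) (?Y {v})"
    proof (intro ballI impI)
      fix v v' assume v: "v \<in> U" "v' \<in> U" "v \<noteq> v'" and Y: "?Y {v, v'} \<noteq> {}"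
      then have "{v, v'} \<noteq> {u, w}" by auto
      then have eq: "?Y {v, v'} = X {v, v'}" by (intro Yother ne'[OF v(3)])
      then have "touches (X {v, v'}) (X {v})" using D(5)[OF v] Y by simp
      then show "touches (?Y {v, v'}) (?Y {v})"
        using touches_mono[OF _ subset_refl Ysub[of v]] unfolding eq by blast
    qed
    show "outer_nbrs C \<subseteq> \<Union>(?Y ` cells U)"
    proof
      fix x assume "x \<in> outer_nbrs C"
      then obtain s where s: "s \<in> cells U" "x \<in> X s" using D(6) by blast
      then show "x \<in> \<Union>(?Y ` cells U)"
        using cu Yu Yother[of s] by (cases "s = {u} \<or> s = {u, w}") blast+
    qed
    show "\<forall>s\<in>cells U. \<exists>c. \<forall>v\<in>?Y s \<inter> outer_nbrs C. col v = c"
    proof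
      fix s assume s: "s \<in> cells U"
      have "?Y s \<inter> outer_nbrs C \<subseteq> X (if s = {u} then {u, w} else s) \<inter> outer_nbrs C"
        using free ne by auto
      moreover have "(if s = {u} then {u, w} else s) \<in> cells U" using s cuw by simp
      ultimately show "\<exists>c. \<forall>v\<in>?Y s \<inter> outer_nbrs C. col v = c" using D(7) by blast
    qed
    show "card U + 2 \<le> k \<or> card U + 1 = k \<and>
        (\<exists>v\<in>U. \<exists>v'\<in>U. v \<noteq> v' \<and> ?Y {v, v'} = {} \<and> touches (?Y {v}) (?Y {v'}))"
    proof (cases "card U + 2 \<le> k")
      case False
      then obtain v v' where v: "card U + 1 = k" "v \<in> U" "v' \<in> U" "v \<noteq> v'" "X {v, v'} = {}"
        "touches (X {v}) (X {v'})" using D(8) by blast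
      have "?Y {v, v'} = {}" using v(4,5) by auto
      moreover have "touches (?Y {v}) (?Y {v'})" using touches_mono[OF v(6) Ysub Ysub] .
      ultimately show ?thesis using v by blast
    qed simp
  qed
qed

text \<open>Nothing in a cell that involves \<open>u\<close> is visible from \<open>C\<close>, so these cells can be forgotten.\<close>

lemma drop_kernel:
  assumes m: "partial_model k C U X col" and u: "u \<in> U"
    and nu: "\<not> touches (X {u}) C"
    and nl: "\<And>w. w \<in> U \<Longrightarrow> w \<noteq> u \<Longrightarrow> \<not> touches (X {u, w}) C"
  shows "partial_model k C (U - {u}) X col"
proof -
  note D = partial_modelD[OF m]
  have sub: "s \<in> cells (U - {u}) \<Longrightarrow> s \<in> cells U" for s
    using cells_mono[of "U - {u}" U] by blast
  have free: "X s \<inter> outer_nbrs C = {}" if s: "s \<in> cells U" "u \<in> s" for s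
  proof -
    have "\<not> touches (X s) C"
      using s(1)
    proof (cases rule: cells_cases)
      case (1 v)
      then show ?thesis using s nu by simp
    next
      case (2 v w)
      then consider "v = u" | "w = u" using s(2) by blast
      then show ?thesis using 2 nl[of w] nl[of v] by cases (auto simp: insert_commute)
    qed
    then show ?thesis using D(2)[OF s(1)] touches_iff_outer_nbrs[of "X s" C] by blast
  qed
  have in_cells: "s \<in> cells (U - {u})" if "s \<in> cells U" "u \<notin> s" for s
    using that by (auto simp: cells_def)
  have card: "card (U - {u}) + 1 = card U" using card_Suc_Diff1[OF D(1) u] by linarith
  show ?thesis
    unfolding partial_model_def
  proof (intro conjI)
    show "outer_nbrs C \<subseteq> \<Union>(X ` cells (U - {u}))"
    proof
      fix x assume x: "x \<in> outer_nbrs C"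
      then obtain s where s: "s \<in> cells U" "x \<in> X s" using D(6) by blast
      then have "u \<notin> s" using free[of s] x by blast
      then show "x \<in> \<Union>(X ` cells (U - {u}))" using in_cells s by blast
    qed
    have "card (U - {u}) + 2 \<le> k" using D(8) card by linarith
    then show "card (U - {u}) + 2 \<le> k \<or> card (U - {u}) + 1 = k \<and>
        (\<exists>v\<in>U - {u}. \<exists>w\<in>U - {u}. v \<noteq> w \<and> X {v, w} = {} \<and> touches (X {v}) (X {w}))" ..
    show "finite (U - {u})" using D(1) by simp
    show "\<forall>s\<in>cells (U - {u}). X s \<subseteq> V - C \<and> (X s = {} \<or> conn (X s))"
      using D(2,3) sub by blast
    show "\<forall>s\<in>cells (U - {u}). \<forall>s'\<in>cells (U - {u}). s \<noteq> s' \<longrightarrow> X s \<inter> X s' = {}"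
      using D(4) sub by blast
    show "\<forall>v\<in>U - {u}. \<forall>w\<in>U - {u}. v \<noteq> w \<longrightarrow> X {v, w} \<noteq> {} \<longrightarrow> touches (X {v, w}) (X {v})"
      using D(5) by blast
    show "\<forall>s\<in>cells (U - {u}). \<exists>c. \<forall>v\<in>X s \<inter> outer_nbrs C. col v = c"
      using D(7) sub by blast
  qed
qed

text \<open>Absorbing a link makes the kernel adjacent to \<open>C\<close>, and dropping removes it; both steps reduce the
  number of kernels that are not adjacent to \<open>C\<close>.\<close>

lemma anchored_model_exists:
  assumes "partial_model k C U X col"
  shows "\<exists>U' X'. partial_model k C U' X' col \<and> anchored C U' X'"
  using assms
proof (induction "card {u\<in>U. \<not> touches (X {u}) C}" arbitrary: U X rule: less_induct)
  case less
  let ?loose = "\<lambda>U X. {u\<in>U. \<not> touches (X {u}) C}"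
  have fin: "finite U" using partial_modelD(1)[OF less.prems] .
  show ?case
  proof (cases "anchored C U X")
    case True
    then show ?thesis using less.prems by blast
  next
    case False
    then obtain u where u: "u \<in> U" "\<not> touches (X {u}) C" by (auto simp: anchored_def)
    show ?thesis
    proof (cases "\<exists>w\<in>U. w \<noteq> u \<and> touches (X {u, w}) C")
      case True
      then obtain w where w: "w \<in> U" "w \<noteq> u" "touches (X {u, w}) C" by blast
      let ?Y = "X({u} := X {u} \<union> X {u, w}, {u, w} := {})"
      have m: "partial_model k C U ?Y col"
        using absorb_link[OF less.prems u(1) w(1) _ u(2) w(3)] w(2) by blast
      have "?Y {u} = X {u} \<union> X {u, w}" using w(2) by auto
      then have tu: "touches (?Y {u}) C" using touches_mono[OF w(3), of "?Y {u}" C] by simp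
      have keep: "?Y {v} = X {v}" if "v \<noteq> u" for v using that w(2) by auto
      have "?loose U ?Y \<subseteq> ?loose U X - {u}"
      proof
        fix v assume v: "v \<in> ?loose U ?Y"
        then have "v \<noteq> u" using tu by blast
        then show "v \<in> ?loose U X - {u}" using v keep by (metis (no_types, lifting) Diff_iff mem_Collect_eq singletonD)
      qed
      then have "?loose U ?Y \<subset> ?loose U X" using u by blast
      then have "card (?loose U ?Y) < card (?loose U X)" using fin by (intro psubset_card_mono) auto
      then show ?thesis using less.hyps m by blast
    next
      case False
      then have m: "partial_model k C (U - {u}) X col"
        using drop_kernel[OF less.prems u] by blast
      have "?loose (U - {u}) X \<subset> ?loose U X" using u by auto
      then have "card (?loose (U - {u}) X) < card (?loose U X)"
        using fin by (intro psubset_card_mono) auto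
      then show ?thesis using less.hyps m by blast
    qed
  qed
qed

text \<open>The branch sets are \<open>C\<close> itself and the kernels, each enlarged by the links to the kernels with a
  larger index.\<close>

lemma complete_model_clique_minor:
  assumes C: "conn C" "C \<subseteq> V" and m: "partial_model k C U X col" and a: "anchored C U X"
    and complete: "\<And>u w. \<not> missing_link U X u w"
  shows "clique_minor (card U + 1)"
proof -
  note D = partial_modelD[OF m]
  obtain z where z: "z \<notin> U" using D(1) ex_new_if_finite[OF infinite_UNIV_nat] by blast
  define B where
    "B u = (if u = z then C else X {u} \<union> \<Union>((\<lambda>w. X {u, w}) ` {w\<in>U. u < w}))" for u
  have Bz: "B z = C" by (simp add: B_def)
  have B: "B u = X {u} \<union> \<Union>((\<lambda>w. X {u, w}) ` {w\<in>U. u < w})" if "u \<in> U" for u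
    using that z by (auto simp: B_def)
  have kernel: "X {u} \<subseteq> B u" if "u \<in> U" for u using B[OF that] by blast
  have in_cell: "\<exists>s\<in>cells U. x \<in> X s \<and> Min s = u" if xu: "x \<in> B u" "u \<in> U" for x u
  proof -
    consider "x \<in> X {u}" | w where "w \<in> U" "u < w" "x \<in> X {u, w}"
      using xu(1) unfolding B[OF xu(2)] by blast
    then show ?thesis
    proof cases
      case 1
      then show ?thesis using xu(2) by (intro bexI[of _ "{u}"]) (auto simp: singleton_in_cells)
    next
      case 2
      then show ?thesis using xu(2) by (intro bexI[of _ "{u, w}"]) (auto simp: pair_in_cells)
    qed
  qed
  have inV: "B u \<subseteq> V - C" if "u \<in> U" for u using in_cell[OF _ that] D(2) by blast
  have connB: "conn (B u)" if u: "u \<in> U" for u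
  proof -
    have "conn (X {u})"
      using D(3)[of "{u}"] a u by (auto simp: singleton_in_cells anchored_def touches_def)
    moreover have "X {u, w} = {} \<or> conn (X {u, w}) \<and> touches (X {u, w}) (X {u})"
      if "w \<in> U" "u < w" for w
      using D(3)[of "{u, w}"] D(5)[of u w] u that by (auto simp: pair_in_cells)
    ultimately show ?thesis
      unfolding B[OF u] using D(1) by (intro conn_Un_Union) auto
  qed
  have disj: "B u \<inter> B w = {}" if uw: "u \<in> U" "w \<in> U" "u \<noteq> w" for u w
    using in_cell[OF _ uw(1)] in_cell[OF _ uw(2)] uw(3) D(4) by (metis disjoint_iff)
  have touch_less: "touches (B u) (B w)" if uw: "u \<in> U" "w \<in> U" "u < w" for u w
  proof (cases "X {u, w} = {}")
    case True
    then have "touches (X {u}) (X {w})"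
      using complete[of u w] uw by (auto simp: missing_link_def)
    then show ?thesis using touches_mono kernel uw by blast
  next
    case False
    then have "touches (X {u, w}) (X {w})"
      using D(5)[of w u] uw by (auto simp: insert_commute)
    moreover have "X {u, w} \<subseteq> B u" using B[OF uw(1)] uw by blast
    ultimately show ?thesis using touches_mono kernel uw by blast
  qed
  have touch: "touches (B u) (B w)" if uw: "u \<in> U" "w \<in> U" "u \<noteq> w" for u w
    using touch_less uw touches_sym by (metis nat_neq_iff)
  have touchC: "touches (B u) C" if "u \<in> U" for u
    using a that touches_mono kernel by (auto simp: anchored_def)
  show ?thesis
    unfolding clique_minor_def
  proof (intro exI[of _ "insert z U"] exI[of _ B] conjI ballI impI)
    show "finite (insert z U)" "card (insert z U) = card U + 1" using D(1) z by simp_all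
    show "B i \<subseteq> V" "conn (B i)" if "i \<in> insert z U" for i
      using that C Bz inV connB by auto
    fix i j assume ij: "i \<in> insert z U" "j \<in> insert z U" "i \<noteq> j"
    show "B i \<inter> B j = {}" using ij disj inV Bz by blast
    show "touches (B i) (B j)" using ij touch touchC Bz touches_sym by blast
  qed
qed

text \<open>Each visible colour belongs to a nonempty cell. With at most \<open>k - 2\<close> kernels there are at most
  \<open>(k - 1) choose 2\<close> cells. With \<open>k - 1\<close> kernels there are \<open>k choose 2\<close> cells, of which two are
  empty: the missing link, and the pair of adjacent kernels that the model provides.\<close>

lemma card_touched_colours:
  assumes m: "partial_model k C U X col" and k: "k \<ge> 3"
    and free: "card U + 2 \<le> k \<or> missing_link U X u w"
  shows "card (col ` outer_nbrs C) \<le> (k choose 2) - 2"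
proof -
  note D = partial_modelD[OF m]
  let ?S = "{s\<in>cells U. X s \<noteq> {}}"
  have fin: "finite (cells U)" using finite_cells[OF D(1)] .
  obtain g where g: "\<And>s v. s \<in> cells U \<Longrightarrow> v \<in> X s \<Longrightarrow> v \<in> outer_nbrs C \<Longrightarrow> col v = g s"
    using D(7) by (metis IntI)
  have "col ` outer_nbrs C \<subseteq> g ` ?S"
  proof
    fix c assume "c \<in> col ` outer_nbrs C"
    then obtain v where v: "v \<in> outer_nbrs C" "c = col v" by blast
    then obtain s where "s \<in> cells U" "v \<in> X s" using D(6) by blast
    then show "c \<in> g ` ?S" using g v by blast
  qed
  then have "card (col ` outer_nbrs C) \<le> card (g ` ?S)"
    using fin by (intro card_mono) auto
  also have "\<dots> \<le> card ?S" using fin by (intro card_image_le) auto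
  also have "\<dots> \<le> (k choose 2) - 2"
  proof (cases "card U + 2 \<le> k")
    case True
    have "card ?S \<le> card (cells U)" using fin by (intro card_mono) auto
    also have "\<dots> = (Suc (card U) choose 2)" using card_cells[OF D(1)] by (simp add: numeral_2_eq_2)
    also have "\<dots> \<le> (k - 1 choose 2)" using True by (intro binomial_right_mono) auto
    also have "\<dots> \<le> (k choose 2) - 2"
    proof -
      obtain j where j: "k = Suc j" "j \<ge> 2" using k by (cases k) auto
      then show ?thesis by (simp add: numeral_2_eq_2)
    qed
    finally show ?thesis .
  next
    case False
    with free have miss: "missing_link U X u w" by blast
    from False D(8) obtain v v' where v: "card U + 1 = k" "v \<in> U" "v' \<in> U" "v \<noteq> v'"
      "X {v, v'} = {}" "touches (X {v}) (X {v'})" by blast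
    \<comment> \<open>The kernels of \<open>v\<close> and \<open>v'\<close> are adjacent, those of \<open>u\<close> and \<open>w\<close> are not.\<close>
    have ne: "{u, w} \<noteq> {v, v'}"
      using miss v(6) touches_sym by (auto simp: missing_link_def doubleton_eq_iff)
    have "?S \<subseteq> cells U - {{u, w}, {v, v'}}" using miss v(5) by (auto simp: missing_link_def)
    then have "card ?S \<le> card (cells U - {{u, w}, {v, v'}})" using fin by (intro card_mono) auto
    also have "\<dots> = card (cells U) - 2"
      using miss v ne by (subst card_Diff_subset) (auto simp: missing_link_def pair_in_cells)
    also have "card (cells U) = (k choose 2)"
      using card_cells[OF D(1)] v(1) by (simp add: numeral_2_eq_2 flip: v(1))
    finally show ?thesis .
  qed
  finally show ?thesis .
qed

text \<open>The new path colour \<open>c\<close> is shown by the new link only. Afterwards \<open>C\<close> may be replaced by any part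
  \<open>C'\<close> of the rest, such as one of its components.\<close>

lemma add_link:
  assumes m: "partial_model k C U X col" and miss: "missing_link U X u w"
    and C: "C \<subseteq> V"
    and Q: "Q \<subseteq> C" "conn Q" "touches Q (X {u})" "touches Q (X {w})"
    and C': "C' \<subseteq> C - Q" "outer_nbrs C' \<subseteq> outer_nbrs C \<union> Q"
    and col': "\<And>v. v \<in> outer_nbrs C \<Longrightarrow> col' v = col v" "\<And>v. v \<in> Q \<Longrightarrow> col' v = c"
  shows "partial_model k C' U (X({u, w} := Q)) col'"
    (is "partial_model k C' U ?Y col'")
proof -
  note D = partial_modelD[OF m]
  have uw: "u \<in> U" "w \<in> U" "u \<noteq> w" "X {u, w} = {}" "\<not> touches (X {u}) (X {w})"
    using miss by (auto simp: missing_link_def)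
  have cuw: "{u, w} \<in> cells U" using uw by (simp add: pair_in_cells)
  have Y: "?Y s = (if s = {u, w} then Q else X s)" for s by simp
  have Ysing: "?Y {v} = X {v}" for v using uw(3) by auto
  have XQ: "X s \<inter> Q = {}" if "s \<in> cells U" for s using D(2)[OF that] Q(1) by blast
  show ?thesis
    unfolding partial_model_def
  proof (intro conjI)
    show "finite U" by (rule D(1))
    show "\<forall>s\<in>cells U. ?Y s \<subseteq> V - C' \<and> (?Y s = {} \<or> conn (?Y s))"
    proof
      fix s assume s: "s \<in> cells U"
      show "?Y s \<subseteq> V - C' \<and> (?Y s = {} \<or> conn (?Y s))"
        using D(2)[OF s] D(3)[OF s] Q(1,2) C C'(1) unfolding Y by auto
    qed
    show "\<forall>s\<in>cells U. \<forall>s'\<in>cells U. s \<noteq> s' \<longrightarrow> ?Y s \<inter> ?Y s' = {}"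
    proof (intro ballI impI)
      fix s s' assume s: "s \<in> cells U" "s' \<in> cells U" "s \<noteq> s'"
      then show "?Y s \<inter> ?Y s' = {}" using D(4)[OF s] XQ[of s] XQ[of s'] unfolding Y by auto
    qed
    show "\<forall>v\<in>U. \<forall>v'\<in>U. v \<noteq> v' \<longrightarrow> ?Y {v, v'} \<noteq> {} \<longrightarrow> touches (?Y {v, v'}) (?Y {v})"
    proof (intro ballI impI)
      fix v v' assume v: "v \<in> U" "v' \<in> U" "v \<noteq> v'" and ne: "?Y {v, v'} \<noteq> {}"
      show "touches (?Y {v, v'}) (?Y {v})"
      proof (cases "{v, v'} = {u, w}")
        case True
        then have "v = u \<or> v = w" by blast
        then have "touches Q (X {v})" using Q(3,4) by blast
        then show ?thesis using True Ysing[of v] by simp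
      next
        case False
        then have "?Y {v, v'} = X {v, v'}" by simp
        then show ?thesis using D(5)[OF v] ne Ysing[of v] by simp
      qed
    qed
    show "outer_nbrs C' \<subseteq> \<Union>(?Y ` cells U)"
    proof
      fix x assume "x \<in> outer_nbrs C'"
      then consider "x \<in> outer_nbrs C" | "x \<in> Q" using C'(2) by blast
      then show "x \<in> \<Union>(?Y ` cells U)"
      proof cases
        case 1
        then obtain s where s: "s \<in> cells U" "x \<in> X s" using D(6) by blast
        then have "x \<in> ?Y s" using uw(4) by auto
        then show ?thesis using s by blast
      next
        case 2
        then have "x \<in> ?Y {u, w}" by simp
        then show ?thesis using cuw by blast
      qed
    qed
    show "\<forall>s\<in>cells U. \<exists>c. \<forall>v\<in>?Y s \<inter> outer_nbrs C'. col' v = c"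
    proof
      fix s assume s: "s \<in> cells U"
      show "\<exists>c. \<forall>v\<in>?Y s \<inter> outer_nbrs C'. col' v = c"
      proof (cases "s = {u, w}")
        case True
        then show ?thesis using col'(2) by auto
      next
        case False
        obtain e where "\<And>v. v \<in> X s \<inter> outer_nbrs C \<Longrightarrow> col v = e" using D(7)[OF s] by blast
        then have "\<forall>v\<in>X s \<inter> outer_nbrs C'. col' v = e"
          using XQ[OF s] C'(2) col'(1) by blast
        then show ?thesis using False by auto
      qed
    qed
    show "card U + 2 \<le> k \<or> card U + 1 = k \<and>
        (\<exists>v\<in>U. \<exists>v'\<in>U. v \<noteq> v' \<and> ?Y {v, v'} = {} \<and> touches (?Y {v}) (?Y {v'}))"
    proof (cases "card U + 2 \<le> k")
      case False
      then obtain v v' where v: "card U + 1 = k" "v \<in> U" "v' \<in> U" "v \<noteq> v'" "X {v, v'} = {}"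
        "touches (X {v}) (X {v'})" using D(8) by blast
      have "{v, v'} \<noteq> {u, w}" using v(6) uw(5) touches_sym by (auto simp: doubleton_eq_iff)
      then have "?Y {v, v'} = {}" using v(5) by simp
      then show ?thesis using v Ysing by metis
    qed simp
  qed
qed

text \<open>The vertex \<open>x\<close> is chosen next to an existing kernel, whenever there is one. This pair of adjacent
  kernels is the empty cell which the model has to provide once it has \<open>k - 1\<close> kernels.\<close>

lemma add_vertex:
  assumes m: "partial_model k C U X col" and k: "k \<ge> 3" and small: "card U + 2 \<le> k"
    and z: "z \<notin> U" and x: "x \<in> C" and C: "C \<subseteq> V"
    and near: "U = {} \<or> (\<exists>u\<in>U. touches {x} (X {u}))"
    and C': "C' \<subseteq> C - {x}" "outer_nbrs C' \<subseteq> outer_nbrs C \<union> {x}"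
    and col': "\<And>v. v \<in> outer_nbrs C \<Longrightarrow> col' v = col v"
  shows "partial_model k C' (insert z U)
           (\<lambda>s. if s = {z} then {x} else if z \<in> s then {} else X s) col'"
    (is "partial_model k C' ?U ?Y col'")
proof -
  note D = partial_modelD[OF m]
  have old: "s \<in> cells U" if "s \<in> cells ?U" "z \<notin> s" for s
    using that by (auto simp: cells_def)
  have new: "s \<in> cells ?U" "z \<notin> s" if "s \<in> cells U" for s
    using that z cells_mono[of U ?U] by (auto simp: cells_def)
  have zc: "{z} \<in> cells ?U" by (simp add: singleton_in_cells)
  have Xx: "x \<notin> X s" if "s \<in> cells U" for s using D(2)[OF that] x by blast
  have Yold: "?Y s = X s" if "z \<notin> s" for s using that by auto
  show ?thesis
    unfolding partial_model_def
  proof (intro conjI)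
    show "finite ?U" using D(1) by simp
    show "\<forall>s\<in>cells ?U. ?Y s \<subseteq> V - C' \<and> (?Y s = {} \<or> conn (?Y s))"
    proof
      fix s assume s: "s \<in> cells ?U"
      show "?Y s \<subseteq> V - C' \<and> (?Y s = {} \<or> conn (?Y s))"
        using old[OF s] D(2)[of s] D(3)[of s] x C C'(1) conn_singleton[of x] by auto
    qed
    show "\<forall>s\<in>cells ?U. \<forall>s'\<in>cells ?U. s \<noteq> s' \<longrightarrow> ?Y s \<inter> ?Y s' = {}"
    proof (intro ballI impI)
      fix s s' assume s: "s \<in> cells ?U" "s' \<in> cells ?U" "s \<noteq> s'"
      then show "?Y s \<inter> ?Y s' = {}"
        using old[of s] old[of s'] D(4)[of s s'] Xx[of s] Xx[of s'] by auto
    qed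
    show "\<forall>v\<in>?U. \<forall>v'\<in>?U. v \<noteq> v' \<longrightarrow> ?Y {v, v'} \<noteq> {} \<longrightarrow> touches (?Y {v, v'}) (?Y {v})"
    proof (intro ballI impI)
      fix v v' assume v: "v \<in> ?U" "v' \<in> ?U" "v \<noteq> v'" and ne: "?Y {v, v'} \<noteq> {}"
      have "{v, v'} \<noteq> {z}" using v(3) by auto
      then have zv: "z \<noteq> v" "z \<noteq> v'" using ne by (auto split: if_splits)
      then show "touches (?Y {v, v'}) (?Y {v})"
        using D(5)[of v v'] v ne by auto
    qed
    show "outer_nbrs C' \<subseteq> \<Union>(?Y ` cells ?U)"
    proof
      fix y assume "y \<in> outer_nbrs C'"
      then consider "y \<in> outer_nbrs C" | "y = x" using C'(2) by blast
      then show "y \<in> \<Union>(?Y ` cells ?U)"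
      proof cases
        case 1
        then obtain s where s: "s \<in> cells U" "y \<in> X s" using D(6) by blast
        then have "y \<in> ?Y s" using Yold new(2) by blast
        then show ?thesis using new(1)[OF s(1)] by blast
      next
        case 2
        then have "y \<in> ?Y {z}" by simp
        then show ?thesis using zc by blast
      qed
    qed
    show "\<forall>s\<in>cells ?U. \<exists>c. \<forall>v\<in>?Y s \<inter> outer_nbrs C'. col' v = c"
    proof
      fix s assume s: "s \<in> cells ?U"
      show "\<exists>c. \<forall>v\<in>?Y s \<inter> outer_nbrs C'. col' v = c"
      proof (cases "z \<in> s")
        case True
        then show ?thesis by auto
      next
        case False
        then have s': "s \<in> cells U" using old s by blast
        obtain e where "\<And>v. v \<in> X s \<inter> outer_nbrs C \<Longrightarrow> col v = e" using D(7)[OF s'] by blast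
        then have "\<forall>v\<in>X s \<inter> outer_nbrs C'. col' v = e"
          using Xx[OF s'] C'(2) col' by blast
        then show ?thesis unfolding Yold[OF False] by blast
      qed
    qed
    show "card ?U + 2 \<le> k \<or> card ?U + 1 = k \<and>
        (\<exists>v\<in>?U. \<exists>v'\<in>?U. v \<noteq> v' \<and> ?Y {v, v'} = {} \<and> touches (?Y {v}) (?Y {v'}))"
    proof (cases "card ?U + 2 \<le> k")
      case False
      have card: "card ?U = card U + 1" using z D(1) by simp
      then have "U \<noteq> {}" using False k by auto
      then obtain u where u: "u \<in> U" "touches {x} (X {u})" using near by blast
      have "z \<noteq> u" using z u(1) by blast
      then have Y: "?Y {z, u} = {}" "?Y {z} = {x}" "?Y {u} = X {u}" by auto
      have "card ?U + 1 = k" using card False small by linarith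
      moreover have "touches (?Y {z}) (?Y {u})" unfolding Y by (rule u(2))
      ultimately show ?thesis using u(1) \<open>z \<noteq> u\<close> Y(1) by blast
    qed simp
  qed
qed

text \<open>One step of the sweep: either a geodesic that becomes a missing link, or a single vertex that
  becomes a new kernel. A free path colour exists by counting the visible ones.\<close>

lemma next_piece:
  assumes k: "k \<ge> 3" and free: "\<not> clique_minor k"
    and C: "conn C" "C \<subseteq> V"
    and m: "partial_model k C U X col" and a: "anchored C U X"
  obtains Q and d :: "'a \<Rightarrow> nat" and c where
    "Q \<subseteq> C" "Q \<noteq> {}" "inj_on d Q"
    "\<And>x y. x \<in> C \<Longrightarrow> y \<in> C \<Longrightarrow> E x y \<Longrightarrow> d y \<le> Suc (d x)"
    "c < (k choose 2) - 1" "c \<notin> col ` outer_nbrs C"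
    "\<And>C' col'. C' \<subseteq> C - Q \<Longrightarrow> outer_nbrs C' \<subseteq> outer_nbrs C \<union> Q \<Longrightarrow>
       \<forall>v\<in>outer_nbrs C. col' v = col v \<Longrightarrow> \<forall>v\<in>Q. col' v = c \<Longrightarrow>
       \<exists>U' X'. partial_model k C' U' X' col'"
proof -
  note D = partial_modelD[OF m]
  have fin: "finite (outer_nbrs C)"
    by (rule finite_subset[OF _ finite_V]) (auto simp: outer_nbrs_def dest: E_sym E_in_V)
  have "(k choose 2) \<ge> (3 choose 2)" using k by (rule binomial_right_mono)
  then have k2: "(k choose 2) \<ge> 3" by (simp add: numeral_3_eq_3 numeral_2_eq_2)
  have fresh: "\<exists>c<(k choose 2) - 1. c \<notin> col ` outer_nbrs C"
    if "card U + 2 \<le> k \<or> missing_link U X u w" for u w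
  proof (rule ccontr)
    assume "\<not> ?thesis"
    then have "{..<(k choose 2) - 1} \<subseteq> col ` outer_nbrs C" by auto
    then have "(k choose 2) - 1 \<le> card (col ` outer_nbrs C)"
      using fin card_mono[of "col ` outer_nbrs C" "{..<(k choose 2) - 1}"] by simp
    then show False using card_touched_colours[OF m k that] k2 by linarith
  qed
  show thesis
  proof (cases "\<exists>u w. missing_link U X u w")
    case True
    then obtain u w where miss: "missing_link U X u w" by blast
    then have uw: "u \<in> U" "w \<in> U" by (auto simp: missing_link_def)
    let ?A = "{x\<in>C. touches {x} (X {u})}"
    obtain a0 where "a0 \<in> C" "touches {a0} (X {u})"
      using a uw(1) E_sym unfolding anchored_def touches_def by blast
    then have A: "?A \<subseteq> C" "?A \<noteq> {}" by blast+
    obtain b where b: "b \<in> C" "touches {b} (X {w})"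
      using a uw(2) E_sym unfolding anchored_def touches_def by blast
    obtain Q and d :: "'a \<Rightarrow> nat" where Q: "Q \<subseteq> C" "conn Q" "b \<in> Q" "Q \<inter> ?A \<noteq> {}"
      and d: "inj_on d Q" "\<And>x y. x \<in> C \<Longrightarrow> y \<in> C \<Longrightarrow> E x y \<Longrightarrow> d y \<le> Suc (d x)"
      by (rule geodesic_exists[OF C(1) A b(1)]) (rule that; assumption)
    have t: "touches Q (X {u})" "touches Q (X {w})"
      using Q(3,4) b(2) by (auto simp: touches_def)
    obtain c where c: "c < (k choose 2) - 1" "c \<notin> col ` outer_nbrs C" using fresh miss by blast
    show thesis
    proof (rule that[OF Q(1) conn_nonempty[OF Q(2)] d c])
      fix C' col' assume "C' \<subseteq> C - Q" "outer_nbrs C' \<subseteq> outer_nbrs C \<union> Q"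
        "\<forall>v\<in>outer_nbrs C. col' v = col v" "\<forall>v\<in>Q. col' v = c"
      then have "partial_model k C' U (X({u, w} := Q)) col'"
        by (intro add_link[OF m miss C(2) Q(1,2) t, of C' col' c]) blast+
      then show "\<exists>U' X'. partial_model k C' U' X' col'" by blast
    qed
  next
    case False
    then have cm: "clique_minor (card U + 1)"
      using complete_model_clique_minor[OF C m a] by blast
    then have small: "card U + 2 \<le> k" using D(8) free by auto
    obtain z where z: "z \<notin> U" using D(1) ex_new_if_finite[OF infinite_UNIV_nat] by blast
    obtain x where x: "x \<in> C" "U = {} \<or> (\<exists>u\<in>U. touches {x} (X {u}))"
    proof (cases "U = {}")
      case True
      then show ?thesis using conn_nonempty[OF C(1)] that by blast
    next
      case False
      then obtain u where u: "u \<in> U" by blast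
      then obtain y where "y \<in> C" "touches {y} (X {u})"
        using a E_sym unfolding anchored_def touches_def by blast
      then show ?thesis using that u by blast
    qed
    obtain c where c: "c < (k choose 2) - 1" "c \<notin> col ` outer_nbrs C" using fresh small by blast
    show thesis
    \<comment> \<open>A single vertex is a geodesic with constant level function; its colour is the fresh \<open>c\<close>.\<close>
    proof (rule that[of "{x}" "\<lambda>_. 0", OF _ _ _ _ c])
      fix C' col' assume "C' \<subseteq> C - {x}" "outer_nbrs C' \<subseteq> outer_nbrs C \<union> {x}"
        "\<forall>v\<in>outer_nbrs C. col' v = col v"
      then show "\<exists>U' X'. partial_model k C' U' X' col'"
        using add_vertex[OF m k small z x(1) C(2) x(2), of C' col'] by blast
    qed (use x(1) in auto)
  qed
qed

section \<open>Ranked colourings of graphs without complete minors\<close>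

text \<open>The colouring \<open>f\<close> extends \<open>f0\<close> to \<open>D\<close>. Everything outside \<open>D\<close> is coloured earlier and counts as
  lower than \<open>D\<close>, so \<open>\<rho>\<close> only compares vertices in \<open>D\<close>.\<close>

definition rank_colouring ::
    "nat \<Rightarrow> 'a set \<Rightarrow> ('a \<Rightarrow> nat) \<Rightarrow> ('a \<Rightarrow> nat) \<Rightarrow> ('a \<Rightarrow> nat) \<Rightarrow> bool" where
  "rank_colouring n D f0 f \<rho> \<longleftrightarrow>
     (\<forall>v. v \<notin> D \<longrightarrow> f v = f0 v) \<and>
     (\<forall>v\<in>D. f v < n) \<and>
     (\<forall>u\<in>D. \<forall>v. E u v \<longrightarrow> f u \<noteq> f v) \<and>
     (\<forall>u\<in>D. \<forall>v\<in>D. E u v \<longrightarrow> \<rho> u \<noteq> \<rho> v) \<and>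
     (\<forall>u\<in>D. \<forall>v v'. E u v \<longrightarrow> E u v' \<longrightarrow> v \<noteq> v' \<longrightarrow>
        (v \<in> D \<longrightarrow> \<rho> v < \<rho> u) \<longrightarrow> (v' \<in> D \<longrightarrow> \<rho> v' < \<rho> u) \<longrightarrow> f v \<noteq> f v')"

lemma rank_colouringD:
  assumes "rank_colouring n D f0 f \<rho>"
  shows "\<And>v. v \<notin> D \<Longrightarrow> f v = f0 v"
    and "\<And>v. v \<in> D \<Longrightarrow> f v < n"
    and "\<And>u v. u \<in> D \<Longrightarrow> E u v \<Longrightarrow> f u \<noteq> f v"
    and "\<And>u v. u \<in> D \<Longrightarrow> v \<in> D \<Longrightarrow> E u v \<Longrightarrow> \<rho> u \<noteq> \<rho> v"
    and "\<And>u v v'. u \<in> D \<Longrightarrow> E u v \<Longrightarrow> E u v' \<Longrightarrow> v \<noteq> v' \<Longrightarrow>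
      (v \<in> D \<longrightarrow> \<rho> v < \<rho> u) \<Longrightarrow> (v' \<in> D \<longrightarrow> \<rho> v' < \<rho> u) \<Longrightarrow> f v \<noteq> f v'"
proof -
  note A = assms[unfolded rank_colouring_def]
  from A[THEN conjunct1] show "\<And>v. v \<notin> D \<Longrightarrow> f v = f0 v" by simp
  from A[THEN conjunct2, THEN conjunct1] show "\<And>v. v \<in> D \<Longrightarrow> f v < n" by simp
  from A[THEN conjunct2, THEN conjunct2, THEN conjunct1]
  show "\<And>u v. u \<in> D \<Longrightarrow> E u v \<Longrightarrow> f u \<noteq> f v" by simp
  from A[THEN conjunct2, THEN conjunct2, THEN conjunct2, THEN conjunct1]
  show "\<And>u v. u \<in> D \<Longrightarrow> v \<in> D \<Longrightarrow> E u v \<Longrightarrow> \<rho> u \<noteq> \<rho> v" by simp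
  from A[THEN conjunct2, THEN conjunct2, THEN conjunct2, THEN conjunct2]
  show "\<And>u v v'. u \<in> D \<Longrightarrow> E u v \<Longrightarrow> E u v' \<Longrightarrow> v \<noteq> v' \<Longrightarrow>
      (v \<in> D \<longrightarrow> \<rho> v < \<rho> u) \<Longrightarrow> (v' \<in> D \<longrightarrow> \<rho> v' < \<rho> u) \<Longrightarrow> f v \<noteq> f v'" by simp
qed

text \<open>Different components of \<open>D\<close> are not adjacent, so their colourings and rankings can be chosen
  independently.\<close>

lemma rank_colouring_glue:
  assumes "\<And>x. x \<in> D \<Longrightarrow> \<exists>f \<rho>. rank_colouring n (component D x) f0 f \<rho>"
  shows "\<exists>f \<rho>. rank_colouring n D f0 f \<rho>"
proof -
  have "\<forall>K\<in>component D ` D. \<exists>g. rank_colouring n K f0 (fst g) (snd g)" using assms by auto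
  then obtain g where "\<forall>K\<in>component D ` D. rank_colouring n K f0 (fst (g K)) (snd (g K))"
    by (rule bchoice[THEN exE])
  then have rc: "rank_colouring n (component D u) f0
      (fst (g (component D u))) (snd (g (component D u)))" if "u \<in> D" for u using that by blast
  define f where "f v = (if v \<in> D then fst (g (component D v)) v else f0 v)" for v
  define \<rho> where "\<rho> v = snd (g (component D v)) v" for v
  have same: "component D v = component D u" if "u \<in> D" "E u v" "v \<in> D" for u v
    using component_eq[OF that(1)] component_step[OF component_self that(2,3)] by blast
  have f_nbr: "f v = fst (g (component D u)) v" if "u \<in> D" "E u v" for u v
  proof (cases "v \<in> D")
    case True
    then show ?thesis using same[OF that] by (simp add: f_def)
  next
    case False
    then have "v \<notin> component D u" using component_subset[OF that(1)] by blast
    then show ?thesis using rank_colouringD(1)[OF rc[OF that(1)]] False by (simp add: f_def)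
  qed
  have \<rho>_nbr: "\<rho> v = snd (g (component D u)) v" if "u \<in> D" "E u v" "v \<in> D" for u v
    using same[OF that] by (simp add: \<rho>_def)
  have in_D: "v \<in> D" if "u \<in> D" "v \<in> component D u" for u v
    using component_subset[OF that(1)] that(2) by blast
  have in_comp: "v \<in> component D u" if "u \<in> D" "E u v" "v \<in> D" for u v
    using component_step[OF component_self that(2,3)] .
  have "rank_colouring n D f0 f \<rho>"
    unfolding rank_colouring_def
  proof (intro conjI allI ballI impI)
    show "f v = f0 v" if "v \<notin> D" for v using that by (simp add: f_def)
    show "f v < n" if "v \<in> D" for v
      using rank_colouringD(2)[OF rc[OF that] component_self] that by (simp add: f_def)
    show "f u \<noteq> f v" if "u \<in> D" "E u v" for u v
      using rank_colouringD(3)[OF rc[OF that(1)] component_self that(2)] f_nbr[OF that] that(1)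
      by (simp add: f_def)
    show "\<rho> u \<noteq> \<rho> v" if "u \<in> D" "v \<in> D" "E u v" for u v
      using rank_colouringD(4)[OF rc[OF that(1)] component_self in_comp[OF that(1,3,2)] that(3)]
        \<rho>_nbr[OF that(1,3,2)] by (simp add: \<rho>_def)
    show "f v \<noteq> f v'" if u: "u \<in> D" and v: "E u v" "E u v'" "v \<noteq> v'"
      and low: "v \<in> D \<longrightarrow> \<rho> v < \<rho> u" "v' \<in> D \<longrightarrow> \<rho> v' < \<rho> u" for u v v'
      unfolding f_nbr[OF u v(1)] f_nbr[OF u v(2)]
    proof (rule rank_colouringD(5)[OF rc[OF u] component_self v]; intro impI)
      assume "v \<in> component D u"
      then show "snd (g (component D u)) v < snd (g (component D u)) u"
        using low(1) in_D[OF u] \<rho>_nbr[OF u v(1)] by (simp add: \<rho>_def)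
    next
      assume "v' \<in> component D u"
      then show "snd (g (component D u)) v' < snd (g (component D u)) u"
        using low(2) in_D[OF u] \<rho>_nbr[OF u v(2)] by (simp add: \<rho>_def)
    qed
  qed
  then show ?thesis by blast
qed

lemma mod_3_neq:
  fixes i j :: nat
  assumes "i \<noteq> j" "i \<le> j + 2" "j \<le> i + 2"
  shows "i mod 3 \<noteq> j mod 3"
proof
  assume "i mod 3 = j mod 3"
  then have "3 * (i div 3) + j = 3 * (j div 3) + i"
    using mult_div_mod_eq[of 3 i] mult_div_mod_eq[of 3 j] by linarith
  then show False using assms by (cases "i div 3" "j div 3" rule: linorder_cases) linarith+
qed

text \<open>The piece \<open>Q\<close> is ranked by its levels, below the rest of \<open>C\<close>. A vertex of \<open>Q\<close> has at most one
  lower neighbour in \<open>Q\<close>, and its other lower neighbours lie outside \<open>C\<close>, where the path colour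
  \<open>c\<close> is not visible.\<close>

lemma rank_colouring_prepend:
  fixes d :: "'a \<Rightarrow> nat"
  assumes C: "C \<subseteq> V" and Q: "Q \<subseteq> C" and inj: "inj_on d Q"
    and lip: "\<And>x y. x \<in> C \<Longrightarrow> y \<in> C \<Longrightarrow> E x y \<Longrightarrow> d y \<le> Suc (d x)"
    and c: "3 * c + 2 < n" "\<And>v. v \<in> outer_nbrs C \<Longrightarrow> f0 v div 3 \<noteq> c"
    and distinct: "\<And>u v v'. u \<in> C \<Longrightarrow> E u v \<Longrightarrow> E u v' \<Longrightarrow> v \<notin> C \<Longrightarrow> v' \<notin> C \<Longrightarrow> v \<noteq> v' \<Longrightarrow>
      f0 v \<noteq> f0 v'"
    and f1: "\<And>v. f1 v = (if v \<in> Q then 3 * c + d v mod 3 else f0 v)"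
    and rc: "rank_colouring n (C - Q) f1 f \<rho>"
  shows "\<exists>\<rho>'. rank_colouring n C f0 f \<rho>'"
proof -
  note R = rank_colouringD[OF rc]
  have fQ: "f v = 3 * c + d v mod 3" if "v \<in> Q" for v using R(1)[of v] that by (simp add: f1)
  have fQ_div: "f v div 3 = c" if "v \<in> Q" for v using fQ[OF that] by simp
  have fout: "f v = f0 v" if "v \<notin> C" for v using R(1)[of v] that Q by (auto simp: f1)
  have out: "f v div 3 \<noteq> c" if "u \<in> C" "E u v" "v \<notin> C" for u v
    using c(2)[of v] fout[OF that(3)] that by (auto simp: outer_nbrs_def)
  have "finite Q" using finite_subset[OF _ finite_V] Q C by blast
  then have "\<exists>M. \<forall>i\<in>d ` Q. i < M" unfolding finite_nat_set_iff_bounded[symmetric] by (rule finite_imageI)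
  then obtain M where M: "\<And>v. v \<in> Q \<Longrightarrow> d v < M" by blast
  \<comment> \<open>The offset \<open>M\<close> puts all of \<open>Q\<close> below the rest of \<open>C\<close>.\<close>
  define \<rho>' where "\<rho>' v = (if v \<in> Q then d v else M + \<rho> v)" for v
  have low_in_Q: "v \<in> Q" if "u \<in> Q" "v \<in> C" "\<rho>' v < \<rho>' u" for u v
  proof (rule ccontr)
    assume "v \<notin> Q"
    then have "M + \<rho> v < d u" using that by (simp add: \<rho>'_def)
    then show False using M[OF that(1)] by simp
  qed
  have "rank_colouring n C f0 f \<rho>'"
    unfolding rank_colouring_def
  proof (intro conjI allI ballI impI)
    show "f v = f0 v" if "v \<notin> C" for v by (rule fout[OF that])
    show "f v < n" if "v \<in> C" for v
    proof (cases "v \<in> Q")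
      case True
      have "d v mod 3 \<le> 2" using mod_less_divisor[of 3 "d v"] by linarith
      then show ?thesis using fQ[OF True] c(1) by linarith
    qed (use R(2) that in blast)
    show "f u \<noteq> f v" if u: "u \<in> C" and uv: "E u v" for u v
    proof -
      consider "u \<in> C - Q" | "u \<in> Q" "v \<in> C - Q" | "u \<in> Q" "v \<in> Q" | "u \<in> Q" "v \<notin> C"
        using u by blast
      then show ?thesis
      proof cases
        case 1
        then show ?thesis by (rule R(3)[OF _ uv])
      next
        case 2
        then show ?thesis using R(3)[OF 2(2) E_sym[OF uv]] by simp
      next
        case 3
        have "d u \<noteq> d v" using inj 3 uv E_irrefl by (metis inj_onD)
        moreover have "d v \<le> Suc (d u)" "d u \<le> Suc (d v)"
          using lip[OF _ _ uv] lip[OF _ _ E_sym[OF uv]] 3 Q by blast+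
        ultimately have "d u mod 3 \<noteq> d v mod 3" by (intro mod_3_neq) auto
        then show ?thesis using fQ[OF 3(1)] fQ[OF 3(2)] by simp
      next
        case 4
        then show ?thesis using fQ_div[OF 4(1)] out[OF u uv] by metis
      qed
    qed
    show "\<rho>' u \<noteq> \<rho>' v" if "u \<in> C" "v \<in> C" "E u v" for u v
    proof -
      have "u \<noteq> v" using that E_irrefl by blast
      then show ?thesis
        using R(4)[of u v] that M[of u] M[of v] inj_on_eq_iff[OF inj, of u v]
        by (cases "u \<in> Q"; cases "v \<in> Q") (simp_all add: \<rho>'_def)
    qed
    show "f v \<noteq> f v'" if u: "u \<in> C" and v: "E u v" "E u v'" "v \<noteq> v'"
      and low: "v \<in> C \<longrightarrow> \<rho>' v < \<rho>' u" "v' \<in> C \<longrightarrow> \<rho>' v' < \<rho>' u" for u v v'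
    proof (cases "u \<in> Q")
      case False
      then have uD: "u \<in> C - Q" using u by blast
      show ?thesis
        by (rule R(5)[OF uD v]) (use low False in \<open>auto simp: \<rho>'_def\<close>)
    next
      case True
      have Q': "v \<notin> C \<or> v \<in> Q" "v' \<notin> C \<or> v' \<in> Q" using low_in_Q[OF True] low by blast+
      show ?thesis
      proof (cases "v \<in> C"; cases "v' \<in> C")
        assume "v \<notin> C" "v' \<notin> C"
        then show ?thesis using distinct[OF u v(1,2) _ _ v(3)] fout by simp
      next
        assume "v \<in> C" "v' \<notin> C"
        then show ?thesis using Q' fQ_div[of v] out[OF u v(2)] by metis
      next
        assume "v \<notin> C" "v' \<in> C"
        then show ?thesis using Q' fQ_div[of v'] out[OF u v(1)] by metis
      next
        assume vC: "v \<in> C" "v' \<in> C"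
        then have vQ: "v \<in> Q" "v' \<in> Q" using Q' by blast+
        have "d v < d u" "d v' < d u" using low vC vQ True by (auto simp: \<rho>'_def)
        moreover have "d u \<le> Suc (d v)" "d u \<le> Suc (d v')"
          using lip[OF _ u E_sym] v vC by blast+
        ultimately have "d v = d v'" by linarith
        then show ?thesis using inj_onD[OF inj _ vQ] v(3) by blast
      qed
    qed
  qed
  then show ?thesis by blast
qed

text \<open>Induction on the size of the uncoloured set. The hypothesis \<open>distinct\<close> is the invariant that makes
  the positions modulo 3 sufficient: no vertex of \<open>C\<close> has two
  neighbours outside \<open>C\<close> with the same final colour.\<close>

lemma rank_colouring_of_model:
  assumes k: "k \<ge> 3" and free: "\<not> clique_minor k"
    and C: "conn C" "C \<subseteq> V"
    and m: "partial_model k C U X (\<lambda>v. f0 v div 3)"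
    and distinct: "\<And>u v v'. u \<in> C \<Longrightarrow> E u v \<Longrightarrow> E u v' \<Longrightarrow> v \<notin> C \<Longrightarrow> v' \<notin> C \<Longrightarrow> v \<noteq> v' \<Longrightarrow>
      f0 v \<noteq> f0 v'"
  shows "\<exists>f \<rho>. rank_colouring (3 * ((k choose 2) - 1)) C f0 f \<rho>"
  using C m distinct
proof (induction "card C" arbitrary: C U X f0 rule: less_induct)
  case less
  let ?n = "3 * ((k choose 2) - 1)"
  note C = less.prems(1,2)
  obtain U' X' where m: "partial_model k C U' X' (\<lambda>v. f0 v div 3)" and a: "anchored C U' X'"
    using anchored_model_exists[OF less.prems(3)] by blast
  obtain Q and d :: "'a \<Rightarrow> nat" and c where Q: "Q \<subseteq> C" "Q \<noteq> {}" "inj_on d Q"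
    and lip: "\<And>x y. x \<in> C \<Longrightarrow> y \<in> C \<Longrightarrow> E x y \<Longrightarrow> d y \<le> Suc (d x)"
    and c: "c < (k choose 2) - 1" "c \<notin> (\<lambda>v. f0 v div 3) ` outer_nbrs C"
    and next_model: "\<And>C' col'. C' \<subseteq> C - Q \<Longrightarrow> outer_nbrs C' \<subseteq> outer_nbrs C \<union> Q \<Longrightarrow>
       \<forall>v\<in>outer_nbrs C. col' v = f0 v div 3 \<Longrightarrow> \<forall>v\<in>Q. col' v = c \<Longrightarrow>
       \<exists>U' X'. partial_model k C' U' X' col'"
    by (rule next_piece[OF k free C m a]) (rule that; assumption)
  have c': "f0 v div 3 \<noteq> c" if "v \<in> outer_nbrs C" for v using c(2) that by blast
  define f1 where "f1 v = (if v \<in> Q then 3 * c + d v mod 3 else f0 v)" for v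
  have "\<exists>f \<rho>. rank_colouring ?n (C - Q) f1 f \<rho>"
  proof (rule rank_colouring_glue)
    fix x assume x: "x \<in> C - Q"
    let ?K = "component (C - Q) x"
    have K: "?K \<subseteq> C - Q" by (rule component_subset[OF x])
    have "?K \<subset> C" using K Q(1,2) by blast
    then have card: "card ?K < card C"
      using finite_subset[OF C(2) finite_V] by (rule psubset_card_mono[rotated])
    have nbrs: "outer_nbrs ?K \<subseteq> outer_nbrs C \<union> Q"
      using outer_nbrs_component[OF x] K unfolding outer_nbrs_def by blast
    have f1_out: "f1 v div 3 = f0 v div 3" if "v \<in> outer_nbrs C" for v
      using that Q(1) by (auto simp: f1_def outer_nbrs_def)
    have f1_Q: "f1 v div 3 = c" if "v \<in> Q" for v using that by (simp add: f1_def)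
    have "\<exists>U' X'. partial_model k ?K U' X' (\<lambda>v. f1 v div 3)"
      by (rule next_model[OF K nbrs]) (use f1_out f1_Q in blast)+
    then obtain U'' X'' where model: "partial_model k ?K U'' X'' (\<lambda>v. f1 v div 3)" by blast
    have distinct: "f1 v \<noteq> f1 v'" if u: "u \<in> ?K" and v: "E u v" "E u v'" "v \<notin> ?K" "v' \<notin> ?K" "v \<noteq> v'" for u v v'
    proof -
      have uC: "u \<in> C" using u K by blast
      have cases: "v \<in> Q \<or> v \<notin> C \<and> v \<notin> Q \<and> v \<in> outer_nbrs C"
        if "E u v" "v \<notin> ?K" for v
        using component_step[OF u that(1)] that uC Q(1) by (auto simp: outer_nbrs_def)
      consider "v \<in> Q" "v' \<in> Q" | "v \<in> Q" "v' \<in> outer_nbrs C" | "v \<in> outer_nbrs C" "v' \<in> Q"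
        | "v \<notin> C" "v' \<notin> C" "v \<notin> Q" "v' \<notin> Q"
        using cases[OF v(1,3)] cases[OF v(2,4)] by blast
      then show ?thesis
      proof cases
        case 1
        then have vC: "v \<in> C" "v' \<in> C" using Q(1) by blast+
        have "d v \<noteq> d v'" using 1 v(5) Q(3) by (auto dest: inj_onD)
        moreover have "d v \<le> Suc (d u)" "d u \<le> Suc (d v)" "d v' \<le> Suc (d u)" "d u \<le> Suc (d v')"
          using lip[OF uC vC(1) v(1)] lip[OF vC(1) uC E_sym[OF v(1)]]
            lip[OF uC vC(2) v(2)] lip[OF vC(2) uC E_sym[OF v(2)]] by blast+
        ultimately have "d v mod 3 \<noteq> d v' mod 3" by (intro mod_3_neq) auto
        then show ?thesis using 1 by (simp add: f1_def)
      next
        case 2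
        then have "f1 v div 3 \<noteq> f1 v' div 3" using f1_Q[of v] f1_out[of v'] c'[of v'] by simp
        then show ?thesis by auto
      next
        case 3
        then have "f1 v div 3 \<noteq> f1 v' div 3" using f1_Q[of v'] f1_out[of v] c'[of v] by simp
        then show ?thesis by auto
      next
        case 4
        then show ?thesis using less.prems(4)[OF uC v(1,2) _ _ v(5)] by (simp add: f1_def)
      qed
    qed
    have "?K \<subseteq> V" using K C(2) by blast
    then show "\<exists>f \<rho>. rank_colouring ?n ?K f1 f \<rho>"
      by (rule less.hyps[OF card conn_component[OF x] _ model distinct])
  qed
  then obtain f \<rho> where "rank_colouring ?n (C - Q) f1 f \<rho>" by blast
  moreover have "3 * c + 2 < ?n" using c(1) by linarith
  ultimately have "\<exists>\<rho>'. rank_colouring ?n C f0 f \<rho>'"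
    by (intro rank_colouring_prepend[OF C(2) Q(1,3) lip _ c' less.prems(4) f1_def])
  then show ?case by blast
qed

lemma rank_colouring_exists:
  assumes k: "k \<ge> 3" and free: "\<not> clique_minor k"
  obtains f :: "'a \<Rightarrow> nat" and \<rho> :: "'a \<Rightarrow> nat" where
    "\<And>v. v \<in> V \<Longrightarrow> f v < 3 * ((k choose 2) - 1)"
    "\<And>u v. E u v \<Longrightarrow> f u \<noteq> f v"
    "\<And>u v. E u v \<Longrightarrow> \<rho> u \<noteq> \<rho> v"
    "\<And>u v v'. E u v \<Longrightarrow> E u v' \<Longrightarrow> v \<noteq> v' \<Longrightarrow> \<rho> v < \<rho> u \<Longrightarrow> \<rho> v' < \<rho> u \<Longrightarrow> f v \<noteq> f v'"
proof -
  have "\<exists>f \<rho>. rank_colouring (3 * ((k choose 2) - 1)) V (\<lambda>_. 0) f \<rho>"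
  proof (rule rank_colouring_glue)
    fix x assume x: "x \<in> V"
    let ?K = "component V x"
    have K: "?K \<subseteq> V" by (rule component_subset[OF x])
    have none: "v \<in> ?K" if "u \<in> ?K" "E u v" for u v
      using component_step[OF that] E_in_V E_sym that(2) by blast
    then have "outer_nbrs ?K = {}" by (auto simp: outer_nbrs_def)
    then have "partial_model k ?K {} (\<lambda>_. {}) (\<lambda>v. 0 div 3)"
      using k by (auto simp: partial_model_def cells_def)
    then show "\<exists>f \<rho>. rank_colouring (3 * ((k choose 2) - 1)) ?K (\<lambda>_. 0) f \<rho>"
      by (rule rank_colouring_of_model[OF k free conn_component[OF x] K]) (use none in blast)
  qed
  then obtain f \<rho> where rc: "rank_colouring (3 * ((k choose 2) - 1)) V (\<lambda>_. 0) f \<rho>" by blast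
  note R = rank_colouringD[OF rc]
  show thesis
  proof (rule that[of f \<rho>])
    show "f u \<noteq> f v" "\<rho> u \<noteq> \<rho> v" if "E u v" for u v
      using R(3,4) that E_in_V E_sym by blast+
    show "f v \<noteq> f v'" if "E u v" "E u v'" "v \<noteq> v'" "\<rho> v < \<rho> u" "\<rho> v' < \<rho> u" for u v v'
      using R(5)[OF E_in_V[OF that(1)] that(1-3)] that(4,5) by blast
  qed (rule R(2))
qed

end

section \<open>Decomposition into induced parts\<close>

text \<open>A graph in which every vertex has at most one neighbour of lower rank is a forest, so the
  prescribed agreements and disagreements along its edges never conflict. The labels are chosen by
  increasing rank.\<close>

lemma monochromatic_iff_labelling:
  fixes E :: "'a \<Rightarrow> 'a \<Rightarrow> bool" and \<rho> :: "'a \<Rightarrow> nat"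
  assumes E_sym: "\<And>u v. E u v \<Longrightarrow> E v u" and F_sym: "\<And>u v. F u v \<Longrightarrow> F v u"
    and rank: "\<And>u v. E u v \<Longrightarrow> \<rho> u \<noteq> \<rho> v" and bound: "\<And>u v. E u v \<Longrightarrow> \<rho> u < N"
    and parent: "\<And>u v v'. E u v \<Longrightarrow> E u v' \<Longrightarrow> \<rho> v < \<rho> u \<Longrightarrow> \<rho> v' < \<rho> u \<Longrightarrow> v = v'"
  shows "\<exists>bit :: 'a \<Rightarrow> bool. \<forall>u v. E u v \<longrightarrow> (bit u = bit v \<longleftrightarrow> F u v)"
proof -
  have "\<exists>bit :: 'a \<Rightarrow> bool. \<forall>u v. E u v \<longrightarrow> \<rho> u < n \<longrightarrow> \<rho> v < n \<longrightarrow> (bit u = bit v \<longleftrightarrow> F u v)" for n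
  proof (induction n)
    case 0
    then show ?case by simp
  next
    case (Suc n)
    then obtain bit :: "'a \<Rightarrow> bool" where
      bit: "\<And>u v. E u v \<Longrightarrow> \<rho> u < n \<Longrightarrow> \<rho> v < n \<Longrightarrow> bit u = bit v \<longleftrightarrow> F u v" by blast
    \<comment> \<open>The parent of \<open>u\<close>; it is arbitrary if \<open>u\<close> has no lower neighbour.\<close>
    define low where "low u = (THE v. E u v \<and> \<rho> v < \<rho> u)" for u
    have low: "low u = v" if "E u v" "\<rho> v < \<rho> u" for u v
      unfolding low_def using that parent by (intro the_equality) blast+
    define bit' where
      "bit' u = (if \<rho> u = n then bit (low u) = F u (low u) else bit u)" for u
    have top: "bit' u = bit' v \<longleftrightarrow> F u v" if "E u v" "\<rho> u = n" "\<rho> v < n" for u v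
      using low[OF that(1)] that(2,3) by (auto simp: bit'_def)
    have "bit' u = bit' v \<longleftrightarrow> F u v" if uv: "E u v" "\<rho> u < Suc n" "\<rho> v < Suc n" for u v
    proof -
      consider "\<rho> u = n" "\<rho> v < n" | "\<rho> v = n" "\<rho> u < n" | "\<rho> u < n" "\<rho> v < n"
        using rank[OF uv(1)] uv(2,3) by linarith
      then show ?thesis
      proof cases
        case 1
        then show ?thesis by (intro top uv(1))
      next
        case 2
        then have "bit' v = bit' u \<longleftrightarrow> F v u" by (intro top E_sym[OF uv(1)])
        moreover have "F v u \<longleftrightarrow> F u v" using F_sym by blast
        ultimately show ?thesis by (simp add: eq_commute)
      next
        case 3
        then show ?thesis using bit[OF uv(1)] by (simp add: bit'_def)
      qed
    qed
    then show ?case by blast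
  qed
  from this[of N] obtain bit :: "'a \<Rightarrow> bool" where
    bit: "\<forall>u v. E u v \<longrightarrow> \<rho> u < N \<longrightarrow> \<rho> v < N \<longrightarrow> (bit u = bit v \<longleftrightarrow> F u v)" by blast
  have "bit u = bit v \<longleftrightarrow> F u v" if "E u v" for u v
    using bit that bound[OF that] bound[OF E_sym[OF that]] by simp
  then show ?thesis by blast
qed

definition piece_bound :: "nat \<Rightarrow> nat" where
  "piece_bound k = (3 * ((k choose 2) - 1))\<^sup>2"

context finite_simple_graph
begin

lemma clique_minor_of_edge:
  assumes uv: "E u v" and k: "k \<le> 2"
  shows "clique_minor k"
proof -
  have "u \<noteq> v" using uv E_irrefl by blast
  moreover have "u \<in> V" "v \<in> V" using uv E_in_V E_sym by blast+
  ultimately have B: "(if i = 0 then {u} else {v}) \<subseteq> V" "conn (if i = 0 then {u} else {v})" for i :: nat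
    using conn_singleton by auto
  have "i \<noteq> j \<Longrightarrow> i = 0 \<and> j \<noteq> 0 \<or> i \<noteq> 0 \<and> j = 0" if "i < k" "j < k" for i j
    using that k by linarith
  then show ?thesis
    unfolding clique_minor_def
    using B \<open>u \<noteq> v\<close> uv E_sym[OF uv]
    by (intro exI[of _ "{..<k}"] exI[of _ "\<lambda>i. if i = 0 then {u} else {v}"])
      (fastforce simp: touches_def)
qed

text \<open>A set \<open>S i\<close> is given by an ordered pair of colours, encoded in \<open>i\<close>. The two orders of the same
  pair select the two bit classes in the forest spanned by these colours.\<close>

lemma induced_decomposition:
  assumes free: "\<not> clique_minor k"
    and F_sym: "\<And>u v. F u v \<Longrightarrow> F v u" and F_E: "\<And>u v. F u v \<Longrightarrow> E u v"
  shows "\<exists>S :: nat \<Rightarrow> 'a set.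
    (\<forall>u v. F u v \<longrightarrow> (\<exists>i<piece_bound k. u \<in> S i \<and> v \<in> S i)) \<and>
    (\<forall>i. \<forall>u\<in>S i. \<forall>v\<in>S i. E u v \<longrightarrow> F u v)"
proof (cases "k \<ge> 3")
  case False
  then have "\<not> F u v" for u v using clique_minor_of_edge free F_E[of u v] by fastforce
  then show ?thesis by (intro exI[of _ "\<lambda>_. {}"]) simp
next
  case True
  let ?c = "3 * ((k choose 2) - 1)"
  obtain f :: "'a \<Rightarrow> nat" and \<rho> :: "'a \<Rightarrow> nat" where
    col: "\<And>v. v \<in> V \<Longrightarrow> f v < ?c" and proper: "\<And>u v. E u v \<Longrightarrow> f u \<noteq> f v"
    and rank: "\<And>u v. E u v \<Longrightarrow> \<rho> u \<noteq> \<rho> v"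
    and low: "\<And>u v v'. E u v \<Longrightarrow> E u v' \<Longrightarrow> v \<noteq> v' \<Longrightarrow> \<rho> v < \<rho> u \<Longrightarrow> \<rho> v' < \<rho> u \<Longrightarrow> f v \<noteq> f v'"
    by (rule rank_colouring_exists[OF True free]) (rule that; assumption)
  have "\<exists>N. \<forall>i\<in>\<rho> ` V. i < N"
    unfolding finite_nat_set_iff_bounded[symmetric] using finite_V by (rule finite_imageI)
  then obtain N where N: "\<And>v. v \<in> V \<Longrightarrow> \<rho> v < N" by blast
  have "\<exists>bit :: 'a \<Rightarrow> bool. \<forall>u v. E u v \<and> {f u, f v} = A \<longrightarrow> (bit u = bit v \<longleftrightarrow> F u v)" for A
  proof (rule monochromatic_iff_labelling[where \<rho> = \<rho> and N = N])
    fix u v v'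
    show "v = v'" if "E u v \<and> {f u, f v} = A" "E u v' \<and> {f u, f v'} = A" "\<rho> v < \<rho> u" "\<rho> v' < \<rho> u"
    proof -
      have "f v = f v'" using that(1,2) proper[of u v] proper[of u v'] by (auto simp: doubleton_eq_iff)
      then show ?thesis using low[of u v v'] that by blast
    qed
  qed (use E_sym F_sym rank N E_in_V in \<open>auto simp: insert_commute\<close>)
  then have "\<forall>A. \<exists>bit :: 'a \<Rightarrow> bool. \<forall>u v. E u v \<and> {f u, f v} = A \<longrightarrow> (bit u = bit v \<longleftrightarrow> F u v)"
    by (rule allI)
  then obtain bit :: "nat set \<Rightarrow> 'a \<Rightarrow> bool" where
    "\<forall>A. \<forall>u v. E u v \<and> {f u, f v} = A \<longrightarrow> (bit A u = bit A v \<longleftrightarrow> F u v)"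
    by (rule choice[THEN exE])
  then have bit: "bit A u = bit A v \<longleftrightarrow> F u v" if "E u v" "{f u, f v} = A" for A u v
    using that by blast
  define S where "S i = {u. (f u = i div ?c \<or> f u = i mod ?c) \<and>
      (bit {i div ?c, i mod ?c} u \<longleftrightarrow> i div ?c < i mod ?c)}" for i
  show ?thesis
  proof (intro exI[of _ S] conjI allI impI ballI)
    fix u v assume F: "F u v"
    have E: "E u v" by (rule F_E[OF F])
    note uv = E col[OF E_in_V[OF E]] col[OF E_in_V[OF E_sym[OF E]]] proper[OF E]
    \<comment> \<open>The bit of \<open>u\<close> decides about the order of the two colours.\<close>
    define a where "a = (if bit {f u, f v} u then min (f u) (f v) else max (f u) (f v))"
    define b where "b = (if bit {f u, f v} u then max (f u) (f v) else min (f u) (f v))"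
    have ab: "{a, b} = {f u, f v}" "a < ?c" "b < ?c" "bit {f u, f v} u \<longleftrightarrow> a < b"
      using uv by (auto simp: a_def b_def)
    have "bit {f u, f v} v \<longleftrightarrow> a < b" using bit[OF uv(1) refl] F ab(4) by blast
    moreover have decode: "(a * ?c + b) div ?c = a" "(a * ?c + b) mod ?c = b"
      using ab(3) by auto
    have "x \<in> S (a * ?c + b) \<longleftrightarrow> f x \<in> {a, b} \<and> (bit {a, b} x \<longleftrightarrow> a < b)" for x
      unfolding S_def decode by simp
    ultimately have "u \<in> S (a * ?c + b)" "v \<in> S (a * ?c + b)"
      using ab(4) unfolding ab(1) by blast+
    moreover have "a * ?c + b < piece_bound k"
    proof -
      have "a * ?c + b < Suc a * ?c" using ab(3) by simp
      also have "\<dots> \<le> ?c * ?c" using ab(2) by (intro mult_le_mono1) simp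
      finally show ?thesis by (simp only: piece_bound_def power2_eq_square)
    qed
    ultimately show "\<exists>i<piece_bound k. u \<in> S i \<and> v \<in> S i" by blast
  next
    fix i u v assume uv: "u \<in> S i" "v \<in> S i" "E u v"
    then have "{f u, f v} = {i div ?c, i mod ?c}"
      using proper[OF uv(3)] unfolding S_def mem_Collect_eq by (elim conjE disjE) (simp_all add: insert_commute)
    then show "F u v" using bit[OF uv(3)] uv(1,2) unfolding S_def by blast
  qed
qed

end

section \<open>Transfer to pair digraphs\<close>

lemma finite_simple_graph_of_pair_graph:
  assumes "pair_graph H"
  shows "finite_simple_graph (pverts H) (\<lambda>u v. (u, v) \<in> parcs H)"
proof -
  interpret pair_graph H by fact
  show ?thesis
    by unfold_locales (auto simp: pair_finite_verts in_arcsD1 arcs_symmetric dest: no_loops')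
qed

text \<open>Translates closure under adjacency into reachability in the symmetric closure of the subgraph
  induced by a branch set.\<close>

lemma is_minor_complete_if_clique_minor:
  assumes H: "pair_graph H"
    and cm: "finite_simple_graph.clique_minor (pverts H) (\<lambda>u v. (u, v) \<in> parcs H) k"
  shows "is_minor (complete_pgraph k) H"
proof -
  interpret finite_simple_graph "pverts H" "\<lambda>u v. (u, v) \<in> parcs H"
    by (rule finite_simple_graph_of_pair_graph[OF H])
  have connected: "Digraph_Component.connected (with_proj H \<restriction> S)" if S: "conn S" for S
  proof -
    let ?G = "mk_symmetric (with_proj H \<restriction> S)"
    have verts: "pverts ?G = S" by (simp add: mk_symmetric_def)
    have arcs: "(a, b) \<in> parcs ?G" if "a \<in> S" "b \<in> S" "(a, b) \<in> parcs H" for a b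
      using that by (force simp: mk_symmetric_def induce_subgraph_def)
    have "(a, b) \<in> rtrancl_on S (parcs ?G)" if a: "a \<in> S" and b: "b \<in> S" for a b
    proof -
      let ?A = "{x\<in>S. (a, x) \<in> rtrancl_on S (parcs ?G)}"
      have "?A = S"
      proof (rule conn_closed[OF S])
        show "?A \<noteq> {}" using a by blast
        show "y \<in> ?A" if "x \<in> ?A" "y \<in> S" "(x, y) \<in> parcs H" for x y
          using that arcs[of x y] by (auto intro: rtrancl_on_into_rtrancl_on)
      qed blast
      then show ?thesis using b by blast
    qed
    then show ?thesis
      unfolding Digraph_Component.connected_def strongly_connected_def reachable_def
      using conn_nonempty[OF S] by (simp add: verts)
  qed
  obtain I :: "nat set" and B where I: "finite I" "card I = k"
    and B: "\<And>i. i \<in> I \<Longrightarrow> B i \<subseteq> pverts H \<and> conn (B i)"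
    and disj: "\<And>i j. i \<in> I \<Longrightarrow> j \<in> I \<Longrightarrow> i \<noteq> j \<Longrightarrow> B i \<inter> B j = {} \<and> touches (B i) (B j)"
    using cm unfolding clique_minor_def by metis
  obtain g where g: "bij_betw g {..<k} I"
    using ex_bij_betw_nat_finite[OF I(1)] I(2) by (auto simp: atLeast0LessThan)
  have gI: "g x \<in> I" if "x < k" for x using g that by (auto simp: bij_betw_def)
  have gneq: "g x \<noteq> g y" if "x < k" "y < k" "x \<noteq> y" for x y
    using g that by (auto simp: bij_betw_def dest: inj_onD)
  show ?thesis
    unfolding is_minor_def
  proof (intro exI[of _ "B \<circ> g"] conjI ballI impI)
    fix x assume "x \<in> pverts (complete_pgraph k)"
    then have x: "x < k" by (simp add: complete_pgraph_def)
    show "(B \<circ> g) x \<subseteq> pverts H" using B[OF gI[OF x]] by simp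
    show "Digraph_Component.connected (with_proj H \<restriction> (B \<circ> g) x)"
      using connected B[OF gI[OF x]] by simp
    fix y assume "y \<in> pverts (complete_pgraph k)" "x \<noteq> y"
    then show "(B \<circ> g) x \<inter> (B \<circ> g) y = {}"
      using disj[OF gI gI gneq] x by (simp add: complete_pgraph_def)
  next
    fix e assume "e \<in> parcs (complete_pgraph k)"
    then obtain x y where e: "e = (x, y)" "x < k" "y < k" "x \<noteq> y"
      by (auto simp: complete_pgraph_def)
    then have "touches (B (g x)) (B (g y))" using disj[OF gI gI gneq] by blast
    then show "case e of (x, y) \<Rightarrow> \<exists>u\<in>(B \<circ> g) x. \<exists>v\<in>(B \<circ> g) y. (u, v) \<in> parcs H"
      unfolding e(1) touches_def by simp
  qed
qed

text \<open>Every graph is a subgraph of the complete graph on its vertices.\<close>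

lemma is_minor_if_complete_minor:
  assumes M: "pair_graph M" and H: "is_minor (complete_pgraph (card (pverts M))) H"
  shows "is_minor M H"
proof -
  interpret M: pair_graph M by fact
  let ?K = "complete_pgraph (card (pverts M))"
  obtain g where g: "bij_betw g (pverts M) {..<card (pverts M)}"
    using ex_bij_betw_finite_nat[OF M.pair_finite_verts] by (auto simp: atLeast0LessThan)
  have gK: "g x \<in> pverts ?K" if "x \<in> pverts M" for x
    using g that by (auto simp: complete_pgraph_def bij_betw_def)
  have gneq: "g x \<noteq> g y" if "x \<in> pverts M" "y \<in> pverts M" "x \<noteq> y" for x y
    using g that by (auto simp: bij_betw_def dest: inj_onD)
  obtain B where B: "\<forall>x\<in>pverts ?K. B x \<subseteq> pverts H \<and> Digraph_Component.connected (with_proj H \<restriction> B x)"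
    and disj: "\<forall>x\<in>pverts ?K. \<forall>y\<in>pverts ?K. x \<noteq> y \<longrightarrow> B x \<inter> B y = {}"
    and adj: "\<forall>(x, y)\<in>parcs ?K. \<exists>u\<in>B x. \<exists>v\<in>B y. (u, v) \<in> parcs H"
    using H unfolding is_minor_def by blast
  show ?thesis
    unfolding is_minor_def
  proof (intro exI[of _ "B \<circ> g"] conjI ballI impI)
    fix x assume x: "x \<in> pverts M"
    show "(B \<circ> g) x \<subseteq> pverts H" "Digraph_Component.connected (with_proj H \<restriction> (B \<circ> g) x)"
      using B gK[OF x] by simp_all
    fix y assume "y \<in> pverts M" "x \<noteq> y"
    then show "(B \<circ> g) x \<inter> (B \<circ> g) y = {}" using disj gK gneq x by simp
  next
    fix e assume e: "e \<in> parcs M"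
    obtain x y where xy: "e = (x, y)" by (cases e)
    then have "x \<in> pverts M" "y \<in> pverts M" "x \<noteq> y"
      using e M.in_arcsD1 M.in_arcsD2 M.no_loops' by blast+
    then have "(g x, g y) \<in> parcs ?K" using gK gneq by (auto simp: complete_pgraph_def)
    then show "case e of (x, y) \<Rightarrow> \<exists>u\<in>(B \<circ> g) x. \<exists>v\<in>(B \<circ> g) y. (u, v) \<in> parcs H"
      using adj unfolding xy by auto
  qed
qed

section \<open>Refining covers\<close>

definition induced_part :: "'a pair_pre_digraph \<Rightarrow> 'a set \<Rightarrow> 'a pair_pre_digraph" where
  "induced_part G W = \<lparr> pverts = W, parcs = {(x, y) \<in> parcs G. x \<in> W \<and> y \<in> W} \<rparr>"

lemma induced_subgraph_induced_part:
  assumes "pair_wf_digraph G" "W \<subseteq> pverts G"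
  shows "induced_subgraph (with_proj (induced_part G W)) (with_proj G)"
proof -
  have "pair_wf_digraph (induced_part G W)" by unfold_locales (auto simp: induced_part_def)
  then show ?thesis
    using assms
    by (auto simp: induced_subgraph_def subgraph_def compatible_def wf_digraph_wp_iff induced_part_def)
qed

text \<open>The image has exactly the images of arcs, so injectivity on the vertices is enough.\<close>

lemma iso_via_graph_image:
  assumes "pair_wf_digraph G" "inj_on g (pverts G)"
  shows "iso_via g G (graph_image g G)"
proof -
  interpret pair_wf_digraph G by fact
  show ?thesis
    unfolding iso_via_def
  proof (intro conjI ballI iffI)
    show "bij_betw g (pverts G) (pverts (graph_image g G))"
      using assms(2) by (simp add: bij_betw_def graph_image_def)
    fix u v assume uv: "u \<in> pverts G" "v \<in> pverts G"
    show "(g u, g v) \<in> parcs (graph_image g G)" if "(u, v) \<in> parcs G"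
      using that by (force simp: graph_image_def)
    assume "(g u, g v) \<in> parcs (graph_image g G)"
    then obtain x y where xy: "(x, y) \<in> parcs G" "g x = g u" "g y = g v"
      by (auto simp: graph_image_def)
    then have "x = u" "y = v" using uv in_arcsD1[OF xy(1)] in_arcsD2[OF xy(1)] inj_onD[OF assms(2)] by auto
    then show "(u, v) \<in> parcs G" using xy by simp
  qed
qed

text \<open>Each guest is replaced by its restrictions to the \<open>n\<close> sets that belong to its edge set \<open>F\<close>. The
  copy with index \<open>j\<close> is the restriction of guest \<open>j div n\<close> to the set with index \<open>j mod n\<close>.\<close>

lemma ic_g_le_of_decomposition:
  fixes \<G> :: "'g pair_pre_digraph set" and H :: "'h pair_pre_digraph"
  assumes cls: "graph_class \<G>" and her: "hereditary \<G>" and H: "pair_graph H"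
    and cover: "is_cover \<G> H Gs \<phi>" and inj: "injective_cover Gs \<phi>"
    and dec: "\<And>F. (\<And>u v. F u v \<Longrightarrow> F v u) \<Longrightarrow> (\<And>u v. F u v \<Longrightarrow> (u, v) \<in> parcs H) \<Longrightarrow>
      \<exists>S :: nat \<Rightarrow> 'h set. (\<forall>u v. F u v \<longrightarrow> (\<exists>i<n. u \<in> S i \<and> v \<in> S i)) \<and>
        (\<forall>i. \<forall>u\<in>S i. \<forall>v\<in>S i. (u, v) \<in> parcs H \<longrightarrow> F u v)"
  shows "ic_g \<G> H \<le> enat (n * length Gs)"
proof -
  interpret H: pair_graph H by fact
  have guest: "Gs ! i \<in> \<G>" "pair_graph (Gs ! i)" if "i < length Gs" for i
    using cover cls nth_mem[OF that] unfolding is_cover_def graph_class_def by blast+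
  have wf: "pair_wf_digraph (Gs ! i)" if "i < length Gs" for i
    by (rule pair_digraph.pair_wf_digraph[OF pair_graph.axioms(1)[OF guest(2)[OF that]]])
  have hom_vert: "\<phi> (i, x) \<in> pverts H" if "i < length Gs" "x \<in> pverts (Gs ! i)" for i x
    using cover that unfolding is_cover_def graph_hom_def disj_union_def by auto
  have hom_arc: "(\<phi> (i, x), \<phi> (i, y)) \<in> parcs H" if "i < length Gs" "(x, y) \<in> parcs (Gs ! i)" for i x y
    using cover that unfolding is_cover_def graph_hom_def disj_union_def by auto
  have inj_guest: "inj_on (guest_map \<phi> i) (pverts (Gs ! i))" if "i < length Gs" for i
    using inj that unfolding injective_cover_def iso_via_def bij_betw_def by blast
  define F where
    "F i u v \<longleftrightarrow> (\<exists>x y. (x, y) \<in> parcs (Gs ! i) \<and> u = \<phi> (i, x) \<and> v = \<phi> (i, y))" for i u v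
  have "\<exists>S :: nat \<Rightarrow> 'h set. i < length Gs \<longrightarrow>
      (\<forall>u v. F i u v \<longrightarrow> (\<exists>p<n. u \<in> S p \<and> v \<in> S p)) \<and>
      (\<forall>p. \<forall>u\<in>S p. \<forall>v\<in>S p. (u, v) \<in> parcs H \<longrightarrow> F i u v)" for i
  proof (cases "i < length Gs")
    case True
    interpret pair_graph "Gs ! i" by (rule guest(2)[OF True])
    have "F i v u" if "F i u v" for u v using that arcs_symmetric unfolding F_def by blast
    moreover have "(u, v) \<in> parcs H" if "F i u v" for u v
      using that hom_arc[OF True] unfolding F_def by blast
    ultimately show ?thesis using dec[of "F i"] by simp
  qed simp
  then have "\<forall>i. \<exists>S :: nat \<Rightarrow> 'h set. i < length Gs \<longrightarrow>
      (\<forall>u v. F i u v \<longrightarrow> (\<exists>p<n. u \<in> S p \<and> v \<in> S p)) \<and>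
      (\<forall>p. \<forall>u\<in>S p. \<forall>v\<in>S p. (u, v) \<in> parcs H \<longrightarrow> F i u v)" by (rule allI)
  then obtain S :: "nat \<Rightarrow> nat \<Rightarrow> 'h set" where S: "\<forall>i. i < length Gs \<longrightarrow>
      (\<forall>u v. F i u v \<longrightarrow> (\<exists>p<n. u \<in> S i p \<and> v \<in> S i p)) \<and>
      (\<forall>p. \<forall>u\<in>S i p. \<forall>v\<in>S i p. (u, v) \<in> parcs H \<longrightarrow> F i u v)"
    by (rule choice[THEN exE])
  have S_cover: "\<exists>p<n. u \<in> S i p \<and> v \<in> S i p" if "i < length Gs" "F i u v" for i u v
    using S that by simp
  have S_induced: "F i u v" if "i < length Gs" "u \<in> S i p" "v \<in> S i p" "(u, v) \<in> parcs H" for i p u v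
    using S that by simp
  define W where "W j = {x \<in> pverts (Gs ! (j div n)). \<phi> (j div n, x) \<in> S (j div n) (j mod n)}" for j
  define Gs' where "Gs' = map (\<lambda>j. induced_part (Gs ! (j div n)) (W j)) [0..<n * length Gs]"
  define \<phi>' where "\<phi>' jx = \<phi> (fst jx div n, snd jx)" for jx :: "nat \<times> 'g"
  have len: "length Gs' = n * length Gs" by (simp add: Gs'_def)
  have nth: "Gs' ! j = induced_part (Gs ! (j div n)) (W j)" if "j < n * length Gs" for j
    using that by (simp add: Gs'_def)
  have div_less: "j div n < length Gs" if "j < n * length Gs" for j
    using that by (simp add: less_mult_imp_div_less mult.commute)
  have gm: "guest_map \<phi>' j = guest_map \<phi> (j div n)" for j
    by (simp add: guest_map_def \<phi>'_def)
  have W_sub: "W j \<subseteq> pverts (Gs ! (j div n))" for j by (auto simp: W_def)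
  have inj_W: "inj_on (guest_map \<phi> (j div n)) (W j)" if "j < n * length Gs" for j
    using inj_on_subset[OF inj_guest[OF div_less[OF that]] W_sub] .
  have wf': "pair_wf_digraph (induced_part G U)" for G :: "'g pair_pre_digraph" and U
    by unfold_locales (auto simp: induced_part_def)
  have "is_cover \<G> H Gs' \<phi>'"
    unfolding is_cover_def
  proof (intro conjI)
    show "set Gs' \<subseteq> \<G>"
    proof
      fix G assume "G \<in> set Gs'"
      then obtain j where j: "j < n * length Gs" "G = induced_part (Gs ! (j div n)) (W j)"
        by (auto simp: Gs'_def)
      then show "G \<in> \<G>"
        using her guest(1)[OF div_less[OF j(1)]]
          induced_subgraph_induced_part[OF wf[OF div_less[OF j(1)]] W_sub[of j]]
        unfolding hereditary_def by blast
    qed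
    show "graph_hom \<phi>' (disj_union Gs') H"
      unfolding graph_hom_def
    proof (intro conjI ballI allI impI)
      fix jx assume "jx \<in> pverts (disj_union Gs')"
      then obtain j x where jx: "jx = (j, x)" "j < n * length Gs" "x \<in> pverts (Gs' ! j)"
        by (auto simp: disj_union_def len)
      then have "x \<in> W j" by (simp add: nth induced_part_def)
      then show "\<phi>' jx \<in> pverts H"
        using hom_vert[OF div_less[OF jx(2)]] W_sub[of j] by (auto simp: jx(1) \<phi>'_def)
    next
      fix a b assume "(a, b) \<in> parcs (disj_union Gs')"
      then obtain j x y where j: "a = (j, x)" "b = (j, y)" "j < n * length Gs" "(x, y) \<in> parcs (Gs' ! j)"
        by (auto simp: disj_union_def len)
      then have "(x, y) \<in> parcs (Gs ! (j div n))" by (simp add: nth induced_part_def)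
      then show "(\<phi>' a, \<phi>' b) \<in> parcs H"
        using hom_arc[OF div_less[OF j(3)]] by (simp add: j(1,2) \<phi>'_def)
    qed
    show "\<forall>(u, v)\<in>parcs H. \<exists>(x, y)\<in>parcs (disj_union Gs'). \<phi>' x = u \<and> \<phi>' y = v"
    proof (intro ballI, clarify)
      fix u v assume "(u, v) \<in> parcs H"
      from bspec[OF cover[unfolded is_cover_def, THEN conjunct2, THEN conjunct2] this]
      obtain a b where ab: "(a, b) \<in> parcs (disj_union Gs)" "\<phi> a = u" "\<phi> b = v" by auto
      then obtain i x y where i: "a = (i, x)" "b = (i, y)" "i < length Gs" "(x, y) \<in> parcs (Gs ! i)"
        by (auto simp: disj_union_def)
      interpret pair_wf_digraph "Gs ! i" by (rule wf[OF i(3)])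
      have "F i u v" using ab(2,3) i unfolding F_def by blast
      then obtain p where p: "p < n" "u \<in> S i p" "v \<in> S i p" using S_cover i(3) by blast
      let ?j = "i * n + p"
      have j: "?j div n = i" "?j mod n = p" using p(1) by auto
      have "?j < Suc i * n" using p(1) by simp
      also have "\<dots> \<le> length Gs * n" using i(3) by (intro mult_le_mono1) simp
      finally have jl: "?j < n * length Gs" by (simp only: mult.commute)
      have "x \<in> W ?j" "y \<in> W ?j"
        using in_arcsD1[OF i(4)] in_arcsD2[OF i(4)] p(2,3) ab(2,3) unfolding W_def j by (auto simp: i(1,2))
      then have "(x, y) \<in> parcs (Gs' ! ?j)"
        unfolding nth[OF jl] j using i(4) by (simp add: induced_part_def)
      then have "((?j, x), (?j, y)) \<in> parcs (disj_union Gs')"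
        using jl by (simp add: disj_union_def len)
      moreover have "\<phi>' (?j, x) = u" "\<phi>' (?j, y) = v"
        unfolding \<phi>'_def fst_conv snd_conv j using ab(2,3) by (simp_all add: i(1,2))
      ultimately show "\<exists>(x, y)\<in>parcs (disj_union Gs'). \<phi>' x = u \<and> \<phi>' y = v" by blast
    qed
  qed
  moreover have "injective_cover Gs' \<phi>'"
    unfolding injective_cover_def len
  proof (intro allI impI)
    fix j assume j: "j < n * length Gs"
    show "iso_via (guest_map \<phi>' j) (Gs' ! j) (graph_image (guest_map \<phi>' j) (Gs' ! j))"
      unfolding gm nth[OF j]
      by (intro iso_via_graph_image wf') (simp add: induced_part_def inj_W[OF j])
  qed
  moreover have "induced_cover H Gs' \<phi>'"
    unfolding induced_cover_def len
  proof (intro allI impI)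
    fix j assume j: "j < n * length Gs"
    let ?i = "j div n"
    let ?g = "guest_map \<phi> ?i"
    interpret pair_wf_digraph "Gs ! ?i" by (rule wf[OF div_less[OF j]])
    have "graph_image ?g (induced_part (Gs ! ?i) (W j)) = induced_part H (?g ` W j)"
    proof -
      have "map_prod ?g ?g ` {(x, y) \<in> parcs (Gs ! ?i). x \<in> W j \<and> y \<in> W j}
          = {(u, v) \<in> parcs H. u \<in> ?g ` W j \<and> v \<in> ?g ` W j}" (is "?L = ?R")
      proof (intro equalityI subrelI)
        fix u v assume "(u, v) \<in> ?L"
        then show "(u, v) \<in> ?R" using hom_arc[OF div_less[OF j]] by (auto simp: guest_map_def)
      next
        fix u v assume "(u, v) \<in> ?R"
        then obtain x y where xy: "x \<in> W j" "y \<in> W j" "u = ?g x" "v = ?g y" "(u, v) \<in> parcs H"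
          by auto
        then have "u \<in> S ?i (j mod n)" "v \<in> S ?i (j mod n)" by (simp_all add: W_def guest_map_def)
        then have "F ?i u v" using S_induced[OF div_less[OF j]] xy(5) by blast
        then obtain x' y' where xy': "(x', y') \<in> parcs (Gs ! ?i)" "?g x = ?g x'" "?g y = ?g y'"
          using xy(3,4) unfolding F_def guest_map_def by auto
        then have "x = x'" "y = y'"
          using inj_onD[OF inj_guest[OF div_less[OF j]]] W_sub[of j] xy(1,2)
            in_arcsD1[OF xy'(1)] in_arcsD2[OF xy'(1)] by blast+
        then show "(u, v) \<in> ?L" using xy xy'(1) by force
      qed
      then show ?thesis by (simp add: graph_image_def induced_part_def)
    qed
    moreover have "?g ` W j \<subseteq> pverts H"
      using hom_vert[OF div_less[OF j]] W_sub[of j] by (auto simp: guest_map_def)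
    ultimately show "induced_subgraph (with_proj (graph_image (guest_map \<phi>' j) (Gs' ! j))) (with_proj H)"
      unfolding gm nth[OF j] using induced_subgraph_induced_part[OF H.pair_wf_digraph] by simp
  qed
  ultimately show ?thesis
    unfolding ic_g_def len[symmetric] by (intro Inf_lower) blast
qed

lemma ic_g_le_piece_bound:
  fixes \<G> :: "'g pair_pre_digraph set" and H :: "'h pair_pre_digraph"
  assumes "graph_class \<G>" "hereditary \<G>" "pair_graph H"
    and free: "\<not> is_minor (complete_pgraph k) H"
    and t: "c_g \<G> H = enat t"
  shows "ic_g \<G> H \<le> enat (piece_bound k * t)"
proof -
  interpret finite_simple_graph "pverts H" "\<lambda>u v. (u, v) \<in> parcs H"
    by (rule finite_simple_graph_of_pair_graph[OF assms(3)])
  have "\<not> clique_minor k" using is_minor_complete_if_clique_minor[OF assms(3)] free by blast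
  note dec = induced_decomposition[OF this]
  obtain Gs \<phi> where "length Gs = t" "is_cover \<G> H Gs \<phi>" "injective_cover Gs \<phi>"
    using t unfolding c_g_eq_enat_iff by blast
  then show ?thesis using ic_g_le_of_decomposition[OF assms(1-3) _ _ dec] by blast
qed

text \<open>With \<open>m = k - 1\<close>, the number of colours is \<open>3 (m\<^sup>2 + m - 2) / 2 \<le> 7 m\<^sup>2 / 4\<close>, and
  \<open>49 / 16 \<le> 25 / 8\<close>.\<close>

lemma piece_bound_le:
  assumes "k \<ge> 1"
  shows "real (piece_bound k) \<le> 25 * (real k - 1) ^ 4 / 8"
proof (cases "k = 1")
  case True
  then show ?thesis by (simp add: piece_bound_def binomial_eq_0)
next
  case False
  define m where "m = real k - 1"
  have "(k choose 2) \<ge> (2 choose 2)" using assms False by (intro binomial_right_mono) simp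
  then have "real (3 * ((k choose 2) - 1)) = 3 * (real (k choose 2) - 1)" by (simp add: of_nat_diff)
  also have "real (k choose 2) = m * (m + 1) / 2"
  proof -
    have "2 dvd k * (k - 1)" by (cases "even k") simp_all
    from real_of_nat_div[OF this] have "real (k choose 2) = real (k * (k - 1)) / 2"
      unfolding choose_two by simp
    then show ?thesis using assms by (simp add: m_def of_nat_diff algebra_simps)
  qed
  also have "3 * (m * (m + 1) / 2 - 1) = 7 / 4 * m\<^sup>2 - ((m - 3)\<^sup>2 + 3) / 4"
    by (simp add: field_simps power2_eq_square)
  also have "\<dots> \<le> 7 / 4 * m\<^sup>2" by simp
  finally have "real (3 * ((k choose 2) - 1)) \<le> 7 / 4 * m\<^sup>2" .
  then have "(real (3 * ((k choose 2) - 1)))\<^sup>2 \<le> (7 / 4 * m\<^sup>2)\<^sup>2" by (intro power_mono) simp_all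
  also have "\<dots> = 49 / 16 * m ^ 4" by (simp add: power_mult_distrib power2_eq_square power4_eq_xxxx)
  also have "\<dots> \<le> 25 * m ^ 4 / 8" by simp
  finally show ?thesis by (simp add: piece_bound_def m_def)
qed

theorem theorem16:
  fixes \<G> :: "'g pair_pre_digraph set"
  assumes "graph_class \<G>" and "hereditary \<G>"
  shows "(\<forall>(k::nat) (H :: 'h pair_pre_digraph).
            pair_graph H \<longrightarrow> \<not> is_minor (complete_pgraph k) H \<longrightarrow> c_g \<G> H < \<infinity> \<longrightarrow>
            ereal_of_enat (ic_g \<G> H)
              \<le> ereal (25 * (real k - 1) ^ 4 / 8) * ereal_of_enat (c_g \<G> H)) \<and>
         (\<forall>(M :: 'm pair_pre_digraph) (\<H> :: 'h pair_pre_digraph set).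
            pair_graph M \<longrightarrow> graph_class \<H> \<longrightarrow> (\<forall>H\<in>\<H>. \<not> is_minor M H) \<longrightarrow>
            param_bounded (ic_g \<G>) (c_g \<G>) \<H>)"
proof (intro conjI allI impI)
  fix k :: nat and H :: "'h pair_pre_digraph"
  assume H: "pair_graph H" and free: "\<not> is_minor (complete_pgraph k) H" and fin: "c_g \<G> H < \<infinity>"
  obtain t where t: "c_g \<G> H = enat t" using fin by auto
  have "is_minor (complete_pgraph 0) H" by (simp add: is_minor_def complete_pgraph_def)
  then have k: "k \<ge> 1" using free by (cases k) auto
  have "ereal_of_enat (ic_g \<G> H) \<le> ereal_of_enat (enat (piece_bound k * t))"
    unfolding ereal_of_enat_le_iff by (rule ic_g_le_piece_bound[OF assms H free t])
  also have "\<dots> = ereal (real (piece_bound k) * real t)" by simp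
  also have "\<dots> \<le> ereal (25 * (real k - 1) ^ 4 / 8 * real t)"
    unfolding ereal_less_eq by (intro mult_right_mono piece_bound_le[OF k]) simp
  finally show "ereal_of_enat (ic_g \<G> H)
      \<le> ereal (25 * (real k - 1) ^ 4 / 8) * ereal_of_enat (c_g \<G> H)" by (simp add: t)
next
  fix M :: "'m pair_pre_digraph" and \<H> :: "'h pair_pre_digraph set"
  assume M: "pair_graph M" and cls: "graph_class \<H>" and free: "\<forall>H\<in>\<H>. \<not> is_minor M H"
  show "param_bounded (ic_g \<G>) (c_g \<G>) \<H>"
    unfolding param_bounded_def
  proof (intro exI[of _ "\<lambda>n. piece_bound (card (pverts M)) * n"] ballI allI impI)
    fix H n assume H: "H \<in> \<H>" and n: "c_g \<G> H = enat n"
    have "pair_graph H" using cls H by (simp add: graph_class_def)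
    moreover have "\<not> is_minor (complete_pgraph (card (pverts M))) H"
      using is_minor_if_complete_minor[OF M] free H by blast
    ultimately show "ic_g \<G> H \<le> enat (piece_bound (card (pverts M)) * n)"
      by (rule ic_g_le_piece_bound[OF assms _ _ n])
  qed
qed

end
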